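(* Let $p$ be a prime, $\lambda$ a partition, and $i\in\{0,\dots,p-1\}$. Then $\operatorname{nor}_i(\lambda^{\mathrm{rest}})\le\operatorname{rem}_i(\lambda)$, with equality if and only if $\lambda$ does not have a removable $i$-node together with an addable $i$-node lying in a later ramp than that removable node. Furthermore, if equality occurs, then $$(\lambda^{\mathrm{rest}})^{\blacktriangledown i}=(\lambda^{\triangledown i})^{\mathrm{rest}}.$$
   Context: A node is an element $(r,c)\in\mathbb N^2$ ($\mathbb N=\{1,2,\dots\}$); a partition $\lambda$ is identified with its Young diagram $\{(r,c): c\le\lambda_r\}$, with row $1$ at the top. A node of $\lambda$ is removable if removing it leaves a partition; a node not in $\lambda$ is addable if adding it gives a partition. The residue of $(r,c)$ is $c-r$ modulo $p$; an $i$-node is a node of residue $i$. $\lambda$ is $p$-restricted if $\lambda_j-\lambda_{j+1}<p$ for all $j\ge1$. For $l\ge0$, the $l$th ramp is the set of nodes $(r,c)$ with $c-1+(p-1)(r-1)=l$; ramp $m$ is later than ramp $l$ if $m>l$. The $p$-restrictisation $\lambda^{\mathrm{rest}}$ is the $p$-restricted partition obtained from $\lambda$ by moving all the nodes in each ramp as far to the left within that ramp as possible (i.e. if $\lambda$ has $k$ nodes in a ramp, these are replaced with the $k$ nodes of that ramp with smallest column indices). $\operatorname{rem}_i(\lambda)$ is the number of removable $i$-nodes of $\lambda$ and $\lambda^{\triangledown i}$ is the partition obtained from $\lambda$ by removing all removable $i$-nodes. For a $p$-restricted partition $\mu$, the $i$-signature of $\mu$ is the sequence of signs obtained by reading the addable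 and removable $i$-nodes of $\mu$ from top to bottom, writing $+$ for each addable $i$-node and $-$ for each removable $i$-node. The reduced $i$-signature is obtained by successively deleting adjacent pairs $-+$ (in that order) until none remains. The removable $i$-nodes corresponding to the surviving $-$ signs are the normal $i$-nodes of $\mu$; $\operatorname{nor}_i(\mu)$ is their number, and $\mu^{\blacktriangledown i}$ is the partition obtained from $\mu$ by removing all the normal $i$-nodes. *)

theory Defs
  imports "HOL-Computational_Algebra.Primes"
begin

text \<open>
  Nodes are pairs (row, column) of positive integers, with row 1 at the top.  A partition is
  identified with its Young diagram, so partitions are sets of nodes throughout.
\<close>

type_synonym node = "nat \<times> nat"

definition nodes :: "node set" where
  "nodes = {(r, c). 1 \<le> r \<and> 1 \<le> c}"

text \<open>The parts are \<open>l 1 \<ge> l 2 \<ge> \<dots>\<close>; the value \<open>l 0\<close> is irrelevant.\<close>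

definition is_partition :: "node set \<Rightarrow> bool" where
  "is_partition D \<longleftrightarrow>
     (\<exists>l :: nat \<Rightarrow> nat. (\<forall>r\<ge>1. l (Suc r) \<le> l r) \<and> finite {r. 1 \<le> r \<and> l r \<noteq> 0} \<and>
        D = {(r, c) \<in> nodes. c \<le> l r})"

definition removable :: "node set \<Rightarrow> node \<Rightarrow> bool" where
  "removable D n \<longleftrightarrow> n \<in> D \<and> is_partition (D - {n})"

definition addable :: "node set \<Rightarrow> node \<Rightarrow> bool" where
  "addable D n \<longleftrightarrow> n \<in> nodes \<and> n \<notin> D \<and> is_partition (insert n D)"

definition residue :: "nat \<Rightarrow> node \<Rightarrow> int" where
  "residue p n = (int (snd n) - int (fst n)) mod int p"

definition removable_nodes :: "nat \<Rightarrow> nat \<Rightarrow> node set \<Rightarrow> node set" where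
  "removable_nodes p i D = {n. removable D n \<and> residue p n = int i}"

definition addable_nodes :: "nat \<Rightarrow> nat \<Rightarrow> node set \<Rightarrow> node set" where
  "addable_nodes p i D = {n. addable D n \<and> residue p n = int i}"

definition rem :: "nat \<Rightarrow> nat \<Rightarrow> node set \<Rightarrow> nat" where
  "rem p i D = card (removable_nodes p i D)"

definition remove_removable :: "nat \<Rightarrow> nat \<Rightarrow> node set \<Rightarrow> node set" where
  "remove_removable p i D = D - removable_nodes p i D"

text \<open>Truncated subtraction in \<open>ramp_index\<close> is harmless on \<^const>\<open>nodes\<close>.\<close>

definition ramp_index :: "nat \<Rightarrow> node \<Rightarrow> nat" where
  "ramp_index p n = (snd n - 1) + (p - 1) * (fst n - 1)"

definition ramp :: "nat \<Rightarrow> nat \<Rightarrow> node set" where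
  "ramp p l = {n \<in> nodes. ramp_index p n = l}"

definition p_restricted :: "nat \<Rightarrow> node set \<Rightarrow> bool" where
  "p_restricted p D \<longleftrightarrow>
     (\<forall>j\<ge>1. int (card {c. (j, c) \<in> D}) - int (card {c. (Suc j, c) \<in> D}) < int p)"

text \<open>
  For \<open>p \<ge> 2\<close> distinct nodes of a ramp have distinct columns, so a node is among the \<open>k\<close> nodes
  of its ramp with smallest column indices iff fewer than \<open>k\<close> nodes of the ramp have a smaller
  column index.
\<close>

definition restrictisation :: "nat \<Rightarrow> node set \<Rightarrow> node set" where
  "restrictisation p D =
     (\<Union>l. {n \<in> ramp p l. card {m \<in> ramp p l. snd m < snd n} < card (D \<inter> ramp p l)})"

datatype sgn = Plus | Minus

text \<open>
  Signs carry their node, so that one can tell which nodes survive the reduction.  For \<open>p \<ge> 2\<close>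
  a row contains at most one addable or removable \<open>i\<close>-node, so sorting by row is unambiguous.
\<close>

definition signature :: "nat \<Rightarrow> nat \<Rightarrow> node set \<Rightarrow> (sgn \<times> node) list" where
  "signature p i D =
     map (\<lambda>n. (if n \<in> addable_nodes p i D then Plus else Minus, n))
       (sorted_key_list_of_set fst (addable_nodes p i D \<union> removable_nodes p i D))"

inductive cancel :: "(sgn \<times> 'a) list \<Rightarrow> (sgn \<times> 'a) list \<Rightarrow> bool" where
  "cancel (us @ (Minus, a) # (Plus, b) # vs) (us @ vs)"

definition reduction_of :: "(sgn \<times> 'a) list \<Rightarrow> (sgn \<times> 'a) list \<Rightarrow> bool" where
  "reduction_of xs ys \<longleftrightarrow> cancel\<^sup>*\<^sup>* xs ys \<and> (\<nexists>zs. cancel ys zs)"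

definition reduced_signature :: "nat \<Rightarrow> nat \<Rightarrow> node set \<Rightarrow> (sgn \<times> node) list" where
  "reduced_signature p i D = (THE ys. reduction_of (signature p i D) ys)"

definition normal_nodes :: "nat \<Rightarrow> nat \<Rightarrow> node set \<Rightarrow> node set" where
  "normal_nodes p i D = {n. (Minus, n) \<in> set (reduced_signature p i D)}"

definition nor :: "nat \<Rightarrow> nat \<Rightarrow> node set \<Rightarrow> nat" where
  "nor p i D = card (normal_nodes p i D)"

definition remove_normal :: "nat \<Rightarrow> nat \<Rightarrow> node set \<Rightarrow> node set" where
  "remove_normal p i D = D - normal_nodes p i D"


subsection \<open>The reduced signature is well defined\<close>

fun push :: "(sgn \<times> 'a) \<Rightarrow> (sgn \<times> 'a) list \<Rightarrow> (sgn \<times> 'a) list" where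
  "push (Minus, a) ((Plus, b) # ys) = ys"
| "push x ys = x # ys"

lemma cancel_Cons: "cancel xs ys \<Longrightarrow> cancel (x # xs) (x # ys)"
  by (metis append_Cons cancel.simps)

lemma cancels_Cons: "cancel\<^sup>*\<^sup>* xs ys \<Longrightarrow> cancel\<^sup>*\<^sup>* (x # xs) (x # ys)"
  by (induction rule: rtranclp_induct) (auto intro: rtranclp.rtrancl_into_rtrancl cancel_Cons)

lemma cancel_push: "cancel\<^sup>*\<^sup>* (x # ys) (push x ys)"
proof (cases "(x, ys)" rule: push.cases)
  case (1 a b zs)
  then show ?thesis using cancel.intros[of "[]" a b zs] by auto
qed auto

lemma cancels_foldr: "cancel\<^sup>*\<^sup>* xs (foldr push xs [])"
proof (induction xs)
  case (Cons x xs)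
  show ?case
    using rtranclp_trans[OF cancels_Cons[OF Cons.IH] cancel_push] by simp
qed simp

lemma foldr_cancel: "cancel xs ys \<Longrightarrow> foldr push xs [] = foldr push ys []"
  by (induction rule: cancel.induct) simp

lemma foldr_cancels: "cancel\<^sup>*\<^sup>* xs ys \<Longrightarrow> foldr push xs [] = foldr push ys []"
  by (induction rule: rtranclp_induct) (auto dest: foldr_cancel)

lemma foldr_irreducible: "\<nexists>zs. cancel xs zs \<Longrightarrow> foldr push xs [] = xs"
proof (induction xs)
  case (Cons x xs)
  then have IH: "foldr push xs [] = xs" using cancel_Cons by blast
  show ?case
  proof (cases "(x, xs)" rule: push.cases)
    case (1 a b zs)
    then show ?thesis using Cons.prems cancel.intros[of "[]" a b zs] by auto
  qed (use IH in auto)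
qed simp

lemma irreducible_push: "\<nexists>zs. cancel ys zs \<Longrightarrow> \<nexists>zs. cancel (push x ys) zs"
proof (cases "(x, ys)" rule: push.cases)
  case (1 a b zs)
  moreover assume "\<nexists>zs. cancel ys zs"
  ultimately show ?thesis using cancel_Cons by fastforce
qed (auto simp: cancel.simps Cons_eq_append_conv)

lemma irreducible_foldr: "\<nexists>zs. cancel (foldr push xs []) zs"
proof (induction xs)
  case (Cons x xs)
  then show ?case using irreducible_push[of "foldr push xs []" x] by simp
qed (simp add: cancel.simps)

lemma reduction_of_unique: "\<exists>!ys. reduction_of xs ys"
  unfolding reduction_of_def
  using cancels_foldr foldr_cancels foldr_irreducible irreducible_foldr by metis


subsection \<open>The restrictisation is a restricted partition\<close>

lemma finite_row: "finite D \<Longrightarrow> finite {c. (r, c) \<in> D}"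
  by (rule finite_subset[of _ "snd ` D"]) force+

lemma is_partition_iff:
  "is_partition D \<longleftrightarrow> finite D \<and> D \<subseteq> nodes \<and>
     (\<forall>r c r' c'. (r, c) \<in> D \<longrightarrow> 1 \<le> r' \<longrightarrow> r' \<le> r \<longrightarrow> 1 \<le> c' \<longrightarrow> c' \<le> c \<longrightarrow> (r', c') \<in> D)"
  (is "_ \<longleftrightarrow> ?R")
proof
  assume "is_partition D"
  then obtain l :: "nat \<Rightarrow> nat" where l: "\<And>r. 1 \<le> r \<Longrightarrow> l (Suc r) \<le> l r"
    and fin: "finite {r. 1 \<le> r \<and> l r \<noteq> 0}" and D: "D = {(r, c) \<in> nodes. c \<le> l r}"
    unfolding is_partition_def by blast
  have anti: "l r \<le> l r'" if "r' \<le> r" "1 \<le> r'" for r r'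
    using that by (induction rule: dec_induct) (auto intro: order.trans[OF l])
  have "D \<subseteq> Sigma {r. 1 \<le> r \<and> l r \<noteq> 0} (\<lambda>r. {..l r})"
    unfolding D nodes_def by auto
  then have "finite D" by (rule finite_subset) (use fin in auto)
  moreover have "(r', c') \<in> D" if "(r, c) \<in> D" "1 \<le> r'" "r' \<le> r" "1 \<le> c'" "c' \<le> c" for r c r' c'
    using that anti[of r' r] unfolding D nodes_def by auto
  ultimately show ?R unfolding D by blast
next
  assume R: ?R
  define l where "l r = card {c. (r, c) \<in> D}" for r
  have finr: "finite {c. (r, c) \<in> D}" for r
    using R by (intro finite_row) blast
  have row: "{c. (r, c) \<in> D} = {1..l r}" for r
  proof (cases "{c. (r, c) \<in> D} = {}")
    case False
    define m where "m = Max {c. (r, c) \<in> D}"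
    have m: "(r, m) \<in> D" using Max_in[OF finr False] unfolding m_def by simp
    then have r: "1 \<le> r" using R unfolding nodes_def by auto
    have "c \<in> {1..m}" if "(r, c) \<in> D" for c
      using that Max_ge[OF finr, of c r] R unfolding m_def nodes_def by auto
    moreover have "(r, c) \<in> D" if "c \<in> {1..m}" for c
      using R m r that by (metis atLeastAtMost_iff order_refl)
    ultimately have "{c. (r, c) \<in> D} = {1..m}" by blast
    then show ?thesis unfolding l_def by simp
  qed (simp add: l_def)
  have "D = {(r, c) \<in> nodes. c \<le> l r}"
    using R row unfolding nodes_def by (auto simp: set_eq_iff)
  moreover have "l (Suc r) \<le> l r" if "r \<ge> 1" for r
  proof -
    have "{c. (Suc r, c) \<in> D} \<subseteq> {c. (r, c) \<in> D}"
    proof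
      fix c assume "c \<in> {c. (Suc r, c) \<in> D}"
      then have c: "(Suc r, c) \<in> D" by simp
      then have "1 \<le> c" using R unfolding nodes_def by auto
      then show "c \<in> {c. (r, c) \<in> D}" using R c that by (auto dest: le_SucI)
    qed
    then show ?thesis unfolding l_def by (rule card_mono[OF finr])
  qed
  moreover have "finite {r. 1 \<le> r \<and> l r \<noteq> 0}"
  proof (rule finite_subset)
    show "{r. 1 \<le> r \<and> l r \<noteq> 0} \<subseteq> fst ` D"
    proof
      fix r assume "r \<in> {r. 1 \<le> r \<and> l r \<noteq> 0}"
      then have "l r \<in> {c. (r, c) \<in> D}" unfolding row by auto
      then show "r \<in> fst ` D" by force
    qed
  qed (use R in simp)
  ultimately show "is_partition D" unfolding is_partition_def by blast
qed

context
  fixes p :: nat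
  assumes p: "2 \<le> p"
begin

private lemma ramp_eq:
  "ramp p l = (\<lambda>r. (r, l - (p - 1) * (r - 1) + 1)) ` {r. 1 \<le> r \<and> (p - 1) * (r - 1) \<le> l}"
  unfolding ramp_def nodes_def ramp_index_def by (auto simp: image_iff)

private lemma finite_ramp: "finite (ramp p l)"
proof -
  have "r \<le> Suc l" if "1 \<le> r" "(p - 1) * (r - 1) \<le> l" for r
  proof -
    have "1 * (r - 1) \<le> (p - 1) * (r - 1)" using p by (intro mult_right_mono) auto
    then show ?thesis using that by linarith
  qed
  then have "{r. 1 \<le> r \<and> (p - 1) * (r - 1) \<le> l} \<subseteq> {..Suc l}" by auto
  then show ?thesis unfolding ramp_eq by (intro finite_imageI) (rule finite_subset, auto)
qed

private lemma in_ramp: "(r, c) \<in> ramp p l \<longleftrightarrow> 1 \<le> r \<and> 1 \<le> c \<and> c - 1 + (p - 1) * (r - 1) = l"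
  unfolding ramp_def nodes_def ramp_index_def by auto

private lemma ramp_row_inj: "(r, c) \<in> ramp p l \<Longrightarrow> (r, c') \<in> ramp p l \<Longrightarrow> c = c'"
  unfolding in_ramp by auto

text \<open>Arithmetic with the products in ramp indices abstracted to \<open>x\<close>.\<close>

private lemma right_arith: "b - 1 + x = l - 1 \<Longrightarrow> 1 \<le> b \<Longrightarrow> 1 \<le> l \<Longrightarrow> Suc b - 1 + x = l"
  and left_arith: "Suc c - 1 + x = l \<Longrightarrow> 1 \<le> c \<Longrightarrow> c - 1 + x = l - 1 \<and> 1 \<le> l"
  and up_arith: "c - 1 + x + q = l \<Longrightarrow> l = (l - q) + q \<and> c - 1 + x = l - q"
  and right_q_arith: "d - 1 + x = k \<Longrightarrow> 1 \<le> d \<Longrightarrow> l = k + q \<Longrightarrow> d + q - 1 + x = l"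
  and left_q_arith: "c - 1 + x = l \<Longrightarrow> \<not> c \<le> q \<Longrightarrow> y = x + q \<Longrightarrow> c - q - 1 + y = l"
  for b c d k l q x y :: nat
  by linarith+

private lemma ramp_less:
  assumes "(r, c) \<in> ramp p l" "(r', c') \<in> ramp p l"
  shows "c' < c \<longleftrightarrow> r < r'"
proof -
  have *: "r - 1 < r' - 1 \<longleftrightarrow> (p - 1) * (r - 1) < (p - 1) * (r' - 1)" using p by simp
  show ?thesis using assms * unfolding in_ramp by linarith
qed

private lemma card_ramp_row: 
  assumes "(r, c) \<in> ramp p l"
  shows "card (ramp p l) = r + card {m \<in> ramp p l. snd m < c}"
proof -
  let ?A = "{m \<in> ramp p l. \<not> snd m < c}"
  have "bij_betw fst ?A {1..r}"
  proof (rule bij_betwI')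
    fix x y assume "x \<in> ?A" "y \<in> ?A"
    then show "fst x = fst y \<longleftrightarrow> x = y" using ramp_row_inj by (cases x; cases y) auto
  next
    fix x assume x: "x \<in> ?A"
    obtain s d where sd: "x = (s, d)" by (cases x)
    have rs: "(s, d) \<in> ramp p l" and "\<not> d < c" using x sd by auto
    then have "\<not> r < s" using ramp_less[OF assms rs] by blast
    moreover have "1 \<le> s" using rs unfolding in_ramp by blast
    ultimately show "fst x \<in> {1..r}" unfolding sd by simp
  next
    fix s assume s: "s \<in> {1..r}"
    define d where "d = l - (p - 1) * (s - 1) + 1"
    have "(p - 1) * (s - 1) \<le> (p - 1) * (r - 1)" using s by (intro mult_le_mono2) auto
    then have "(p - 1) * (s - 1) \<le> l" using assms unfolding in_ramp by linarith
    then have "d - 1 + (p - 1) * (s - 1) = l" "1 \<le> d" unfolding d_def by linarith+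
    then have rs: "(s, d) \<in> ramp p l" using s unfolding in_ramp by (meson atLeastAtMost_iff)
    have "\<not> r < s" using s by simp
    then have "\<not> d < c" using ramp_less[OF assms rs] by blast
    with rs show "\<exists>x\<in>?A. s = fst x" by (intro bexI[of _ "(s, d)"]) auto
  qed
  then have "card ?A = r" using bij_betw_same_card by fastforce
  moreover have "card (ramp p l) = card (?A \<union> {m \<in> ramp p l. snd m < c})"
    by (rule arg_cong[of _ _ card]) auto
  moreover have "\<dots> = card ?A + card {m \<in> ramp p l. snd m < c}"
    using finite_ramp by (intro card_Un_disjoint) auto
  ultimately show ?thesis by simp
qed

private lemma card_split: "card (ramp p l - D) + card (D \<inter> ramp p l) = card (ramp p l)"
  using card_Int_Diff[OF finite_ramp, of l D] by (simp add: Int_commute)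

private lemma in_restrictisation:
  "(r, c) \<in> restrictisation p D \<longleftrightarrow>
     (\<exists>l. (r, c) \<in> ramp p l \<and> card (ramp p l - D) < r)"
proof -
  have "card {m \<in> ramp p l. snd m < c} < card (D \<inter> ramp p l) \<longleftrightarrow> card (ramp p l - D) < r"
    if "(r, c) \<in> ramp p l" for l
    using card_ramp_row[OF that] card_split[of l D] by linarith
  then show ?thesis unfolding restrictisation_def by auto
qed

lemma card_restrictisation_ramp: "card (restrictisation p D \<inter> ramp p l) = card (D \<inter> ramp p l)"
proof -
  let ?m = "card (ramp p l - D)" and ?N = "card (ramp p l)"
  have le: "r \<le> ?N" if "(r, c) \<in> ramp p l" for r c
    using card_ramp_row[OF that] by simp
  have inj: "inj_on fst (ramp p l)"
    by (auto simp: inj_on_def dest: ramp_row_inj)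
  have "fst ` ramp p l = {1..?N}"
  proof (rule card_subset_eq)
    show "fst ` ramp p l \<subseteq> {1..?N}" 
    proof
      fix r assume "r \<in> fst ` ramp p l"
      then obtain c where rc: "(r, c) \<in> ramp p l" by force
      then have "1 \<le> r" unfolding in_ramp by blast
      then show "r \<in> {1..?N}" using le[OF rc] by simp
    qed
    show "card (fst ` ramp p l) = card {1..?N}" using card_image[OF inj] by simp
  qed simp
  then have "fst ` (restrictisation p D \<inter> ramp p l) = {?m<..?N}"
  proof (intro set_eqI iffI)
    fix r assume "r \<in> fst ` (restrictisation p D \<inter> ramp p l)"
    then obtain c where E: "(r, c) \<in> restrictisation p D" and rc: "(r, c) \<in> ramp p l" by force
    from E obtain k where k: "(r, c) \<in> ramp p k" "card (ramp p k - D) < r"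
      unfolding in_restrictisation by blast
    have "k = l" using k(1) rc unfolding ramp_def by blast
    then show "r \<in> {?m<..?N}" using le[OF rc] k(2) by simp
  next
    fix r assume r: "r \<in> {?m<..?N}"
    then have "r \<in> fst ` ramp p l" using \<open>fst ` ramp p l = _\<close> by auto
    then obtain c where "(r, c) \<in> ramp p l" by force
    moreover from this have "(r, c) \<in> restrictisation p D" using r unfolding in_restrictisation by auto
    ultimately show "r \<in> fst ` (restrictisation p D \<inter> ramp p l)" by force
  qed
  moreover have "inj_on fst (restrictisation p D \<inter> ramp p l)"
    using inj by (rule inj_on_subset) auto
  ultimately have "card (restrictisation p D \<inter> ramp p l) = ?N - ?m"
    using card_image by fastforce
  then show ?thesis using card_split[of l D] by linarith
qed

lemma is_partition_restrictisation:
  assumes D: "is_partition D"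
  shows "is_partition (restrictisation p D)"
proof -
  let ?E = "restrictisation p D"
  have fin: "finite D" and sub: "D \<subseteq> nodes"
    and down: "\<And>r c r' c'. (r, c) \<in> D \<Longrightarrow> 1 \<le> r' \<Longrightarrow> r' \<le> r \<Longrightarrow> 1 \<le> c' \<Longrightarrow> c' \<le> c \<Longrightarrow> (r', c') \<in> D"
    using iffD1[OF is_partition_iff D] by auto
  have "?E \<subseteq> (\<Union>l \<in> ramp_index p ` D. ramp p l)"
  proof
    fix n assume "n \<in> ?E"
    then obtain l where l: "n \<in> ramp p l" "0 < card (D \<inter> ramp p l)"
      unfolding restrictisation_def by fastforce
    then obtain m where "m \<in> D \<inter> ramp p l" by (metis card.empty ex_in_conv less_irrefl)
    then show "n \<in> (\<Union>l \<in> ramp_index p ` D. ramp p l)" using l unfolding ramp_def by (auto intro!: bexI[of _ m])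
  qed
  then have finE: "finite ?E"
    by (rule finite_subset) (use fin finite_ramp in auto)
  have "ramp p l \<subseteq> nodes" for l unfolding ramp_def by blast
  then have subE: "?E \<subseteq> nodes" unfolding restrictisation_def by blast
  have left: "(r, c) \<in> ?E" if E: "(r, Suc c) \<in> ?E" and c: "1 \<le> c" for r c
  proof -
    obtain l where l: "(r, Suc c) \<in> ramp p l" "card (ramp p l - D) < r"
      using E in_restrictisation by blast
    have rc: "1 \<le> r" "Suc c - 1 + (p - 1) * (r - 1) = l"
      using l(1) unfolding in_ramp by blast+
    then have "c - 1 + (p - 1) * (r - 1) = l - 1" "l \<ge> 1"
      using left_arith[OF rc(2) c] by blast+
    then have l': "(r, c) \<in> ramp p (l - 1)" using rc(1) c unfolding in_ramp by blast
    have "card (ramp p (l - 1) - D) \<le> card (ramp p l - D)"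
    proof (rule card_inj_on_le[where f = "\<lambda>(r, c). (r, Suc c)"])
      show "inj_on (\<lambda>(r, c). (r, Suc c)) (ramp p (l - 1) - D)" by (auto simp: inj_on_def)
      show "(\<lambda>(r, c). (r, Suc c)) ` (ramp p (l - 1) - D) \<subseteq> ramp p l - D"
      proof (rule image_subsetI)
        fix n assume "n \<in> ramp p (l - 1) - D"
        then obtain a b where n: "n = (a, b)" and ab: "(a, b) \<in> ramp p (l - 1)" "(a, b) \<notin> D"
          by (cases n) auto
        have 1: "1 \<le> a" "1 \<le> b" "b - 1 + (p - 1) * (a - 1) = l - 1"
          using ab(1) unfolding in_ramp by blast+
        have "(a, Suc b) \<notin> D" using down[of a "Suc b" a b] ab(2) 1(1,2) by auto
        moreover have "Suc b - 1 + (p - 1) * (a - 1) = l" "1 \<le> Suc b"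
          using right_arith[OF 1(3,2) \<open>l \<ge> 1\<close>] by simp_all
        then have "(a, Suc b) \<in> ramp p l" using 1(1) unfolding in_ramp by blast
        ultimately show "(case n of (r, c) \<Rightarrow> (r, Suc c)) \<in> ramp p l - D"
          unfolding n by simp
      qed
    qed (use finite_ramp in simp)
    then show ?thesis using l(2) l' in_restrictisation by (meson le_less_trans)
  qed
  have up: "(r, c) \<in> ?E" if E: "(Suc r, c) \<in> ?E" and r: "1 \<le> r" for r c
  proof -
    obtain l where l: "(Suc r, c) \<in> ramp p l" "card (ramp p l - D) < Suc r"
      using E in_restrictisation by blast
    define k where "k = l - (p - 1)"
    have shift: "(p - 1) * s = (p - 1) * (s - 1) + (p - 1)" if "1 \<le> s" for s
      using that by (cases s) auto
    have c: "1 \<le> c" "c - 1 + (p - 1) * (Suc r - 1) = l"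
      using l(1) unfolding in_ramp by blast+
    then have *: "c - 1 + (p - 1) * (r - 1) + (p - 1) = l"
      using shift[OF r] by (simp only: diff_Suc_1 add.assoc)
    then have lk: "l = k + (p - 1)" "c - 1 + (p - 1) * (r - 1) = k"
      unfolding k_def using up_arith[OF *] by blast+
    then have rk: "(r, c) \<in> ramp p k" using r c(1) unfolding in_ramp by blast
    have move: "(s, d + (p - 1)) \<in> ramp p l - D" "(Suc s, d) \<in> ramp p l - D"
      if sd: "(s, d) \<in> ramp p k" "(s, d) \<notin> D" for s d
    proof -
      have 1: "1 \<le> s" "1 \<le> d" "d - 1 + (p - 1) * (s - 1) = k"
        using sd(1) unfolding in_ramp by blast+
      have "d + (p - 1) - 1 + (p - 1) * (s - 1) = l" "1 \<le> d + (p - 1)"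
        using right_q_arith[OF 1(3,2) lk(1)] 1(2) by (blast, simp)
      then have "(s, d + (p - 1)) \<in> ramp p l" using 1(1) unfolding in_ramp by blast
      moreover have "(s, d + (p - 1)) \<notin> D"
        using down[of s "d + (p - 1)" s d] sd(2) 1(1,2) by auto
      ultimately show "(s, d + (p - 1)) \<in> ramp p l - D" by blast
      have "d - 1 + (p - 1) * (Suc s - 1) = l" "1 \<le> Suc s"
        using 1(3) shift[OF 1(1)] lk(1) by (simp_all only: diff_Suc_1 flip: add.assoc)
      then have "(Suc s, d) \<in> ramp p l" using 1(2) unfolding in_ramp by blast
      moreover have "(Suc s, d) \<notin> D"
        using down[of "Suc s" d s d] sd(2) 1(1,2) by auto
      ultimately show "(Suc s, d) \<in> ramp p l - D" by blast
    qed
    have "card (ramp p k - D) < r"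
    proof (cases "ramp p k \<subseteq> D")
      case True
      then have "ramp p k - D = {}" by blast
      then show ?thesis using r by (simp only: card.empty)
    next
      case False
      text \<open>Nodes of ramp \<open>k\<close> above a given missing one move right, the others move down;
        the node just right of the given one is missed.\<close>
      then obtain a b where ab: "(a, b) \<in> ramp p k" "(a, b) \<notin> D" by auto
      let ?f = "\<lambda>(s, d). if s < a then (s, d + (p - 1)) else (Suc s, d)"
      have abp: "(a, b + (p - 1)) \<in> ramp p l - D" by (rule move(1)[OF ab])
      have "card (ramp p k - D) \<le> card (ramp p l - D - {(a, b + (p - 1))})"
      proof (rule card_inj_on_le[where f = ?f])
        show "inj_on ?f (ramp p k - D)" by (auto simp: inj_on_def split: if_splits)
        show "?f ` (ramp p k - D) \<subseteq> ramp p l - D - {(a, b + (p - 1))}"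
        proof (rule image_subsetI)
          fix n assume "n \<in> ramp p k - D"
          then obtain s d where n: "n = (s, d)" and sd: "(s, d) \<in> ramp p k" "(s, d) \<notin> D"
            by (cases n) auto
          show "?f n \<in> ramp p l - D - {(a, b + (p - 1))}"
          proof (cases "s < a")
            case True
            then show ?thesis using move(1)[OF sd] unfolding n by simp
          next
            case False
            then show ?thesis using move(2)[OF sd] unfolding n by simp
          qed
        qed
      qed (use finite_ramp in simp)
      also have "\<dots> < card (ramp p l - D)"
        using abp finite_ramp by (intro card_Diff1_less) auto
      finally show ?thesis using l(2) by simp
    qed
    then show ?thesis using rk in_restrictisation by blast
  qed
  have left': "(r, c') \<in> ?E" if "(r, c) \<in> ?E" "1 \<le> c'" "c' \<le> c" for r c c'
    using that(3,1) by (induction rule: inc_induct) (use left that(2) in auto)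
  have up': "(r', c) \<in> ?E" if "(r, c) \<in> ?E" "1 \<le> r'" "r' \<le> r" for r r' c
    using that(3,1) by (induction rule: inc_induct) (use up that(2) in auto)
  have "(r', c') \<in> ?E" if "(r, c) \<in> ?E" "1 \<le> r'" "r' \<le> r" "1 \<le> c'" "c' \<le> c" for r c r' c'
    using left'[OF up'[OF that(1-3)] that(4,5)] .
  then show ?thesis using finE subE by (intro iffD2[OF is_partition_iff] conjI allI impI)
qed

lemma p_restricted_restrictisation:
  assumes D: "is_partition D"
  shows "p_restricted p (restrictisation p D)"
  unfolding p_restricted_def
proof (intro allI impI)
  fix j :: nat assume j: "1 \<le> j"
  let ?E = "restrictisation p D"
  let ?R = "\<lambda>j. {c. (j, c) \<in> ?E}"
  have fin: "finite (?R j)" for j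
    using is_partition_restrictisation[OF D] unfolding is_partition_iff
    by (intro finite_row) blast
  have "?R j \<subseteq> {1..p - 1} \<union> (\<lambda>c. c + (p - 1)) ` ?R (Suc j)"
  proof
    fix c assume "c \<in> ?R j"
    then obtain l where l: "(j, c) \<in> ramp p l" "card (ramp p l - D) < j"
      using in_restrictisation by blast
    show "c \<in> {1..p - 1} \<union> (\<lambda>c. c + (p - 1)) ` ?R (Suc j)"
    proof (cases "c \<le> p - 1")
      case False
      have 1: "c - 1 + (p - 1) * (j - 1) = l" using l(1) unfolding in_ramp by blast
      have "(p - 1) * j = (p - 1) * (j - 1) + (p - 1)" using j by (cases j) auto
      then have "c - (p - 1) - 1 + (p - 1) * (Suc j - 1) = l"
        unfolding diff_Suc_1 by (rule left_q_arith[OF 1 False])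
      moreover have "1 \<le> c - (p - 1)" "1 \<le> Suc j" using False by linarith+
      ultimately have "(Suc j, c - (p - 1)) \<in> ramp p l" unfolding in_ramp by blast
      then have "c - (p - 1) \<in> ?R (Suc j)" using l(2) in_restrictisation by fastforce
      then show ?thesis using False by (auto intro!: image_eqI[of _ _ "c - (p - 1)"])
    next
      case True
      moreover have "1 \<le> c" using l(1) unfolding in_ramp by blast
      ultimately show ?thesis by simp
    qed
  qed
  then have "card (?R j) \<le> card ({1..p - 1} \<union> (\<lambda>c. c + (p - 1)) ` ?R (Suc j))"
    using fin by (intro card_mono) auto
  also have "\<dots> \<le> card {1..p - 1} + card ((\<lambda>c. c + (p - 1)) ` ?R (Suc j))" by (rule card_Un_le)
  also have "\<dots> \<le> (p - 1) + card (?R (Suc j))" using card_image_le[OF fin] by simp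
  finally show "int (card (?R j)) - int (card (?R (Suc j))) < int p" using p by linarith
qed

end

end

theory Submission
  imports Defs
begin

text \<open>
  The nodes of ramp \<open>l\<close> have residue \<open>l\<close> modulo \<open>p\<close>.  The number of removable nodes in
  ramp \<open>l\<close> minus the number of addable nodes in ramp \<open>l + p\<close> depends only on the sizes of
  the intersections of the diagram with the ramps, so it is the same for \<open>D\<close> and for its
  restrictisation \<open>E\<close>.  In \<open>E\<close>, reading from top to bottom visits the ramps in increasing order,
  with the addable nodes of a ramp before its removable ones.

  The number of normal nodes of \<open>E\<close> is the excess of minus over plus signs in some suffix of the
  signature.  If this suffix starts with a removable node in ramp \<open>k\<close>, the excess is at most the
  number of removable nodes of \<open>E\<close> in ramps \<open>\<ge> k\<close> minus the number of addable ones in ramps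
  \<open>> k\<close>, and \<open>D\<close> can replace \<open>E\<close> here.  This gives the inequality, and it shows that equality
  excludes an addable node in a later ramp than a removable one.  Conversely, in the absence of
  such a pair, the same balance over intervals of ramps shows that every node of \<open>E\<close> outside the
  restrictisation of \<open>D\<close> without its removable nodes is normal; there are \<open>rem p i D\<close> of them,
  so by the inequality there are no other normal nodes.
\<close>

subsection \<open>Reduction of sign sequences\<close>

definition sign_count :: "sgn \<Rightarrow> (sgn \<times> 'a) list \<Rightarrow> nat" where
  "sign_count s xs = length (filter (\<lambda>x. fst x = s) xs)"

lemma sign_count_simps [simp]:
  "sign_count s [] = 0"
  "sign_count s (x # xs) = (if fst x = s then Suc (sign_count s xs) else sign_count s xs)"
  "sign_count s (xs @ ys) = sign_count s xs + sign_count s ys"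
  by (simp_all add: sign_count_def)

text \<open>A stack machine that reads the word from right to left. It computes the unique
  irreducible form, so facts about reduced signatures can be proved by induction on the
  list.\<close>

abbreviation reduce :: "(sgn \<times> 'a) list \<Rightarrow> (sgn \<times> 'a) list" where
  "reduce xs \<equiv> foldr push xs []"

lemma reduced_signature_eq_reduce: "reduced_signature p i D = reduce (signature p i D)"
proof -
  have "reduction_of (signature p i D) (reduce (signature p i D))"
    unfolding reduction_of_def using cancels_foldr irreducible_foldr by blast
  then show ?thesis
    unfolding reduced_signature_def by (intro the1_equality reduction_of_unique)
qed

lemma push_Plus: "fst x = Plus \<Longrightarrow> push x ys = x # ys"
  by (cases "(x, ys)" rule: push.cases) auto

lemma push_Minus:
  "fst x = Minus \<Longrightarrow>
    push x ys = (case ys of [] \<Rightarrow> [x] | y # zs \<Rightarrow> if fst y = Plus then zs else x # ys)"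
  by (cases "(x, ys)" rule: push.cases) (auto split: list.splits)

lemma sgn_neq: "s \<noteq> Plus \<longleftrightarrow> s = Minus" "s \<noteq> Minus \<longleftrightarrow> s = Plus"
  by (cases s; simp)+

text \<open>A minus directly before a plus would cancel, so in a reduced word all plus signs precede
  all minus signs.\<close>

lemma reduce_sorted: "sorted_wrt (\<lambda>x y. fst x = Minus \<longrightarrow> fst y = Minus) (reduce xs)"
proof (induction xs)
  case (Cons x xs)
  then show ?case
    by (cases "fst x = Plus") (fastforce simp: push_Plus push_Minus sgn_neq split: list.splits)+
qed simp

lemma reduce_hd_Minus:
  assumes "reduce xs = y # ys" "fst y = Minus"
  shows "sign_count Plus (reduce xs) = 0"
  using reduce_sorted[of xs] assms by (auto simp: sign_count_def filter_empty_conv)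

text \<open>Each cancellation deletes one sign of either kind, so the excess of minus over plus is
  invariant; the additive form avoids truncated subtraction.\<close>

lemma sign_count_reduce_balance:
  "sign_count Minus (reduce xs) + sign_count Plus xs = sign_count Plus (reduce xs) + sign_count Minus xs"
proof (induction xs)
  case (Cons x xs)
  then show ?case
    by (cases "fst x = Plus") (auto simp: push_Plus push_Minus sgn_neq split: list.splits)
qed simp

text \<open>The suffix starts at the first surviving minus. Whenever a new minus survives, nothing
  but minus signs is on the stack, and \<open>sign_count_reduce_balance\<close> for the word read so
  far gives the equation; otherwise the number of surviving minus signs is unchanged and the old
  suffix is kept.\<close>

lemma reduce_extremal_suffix:
  "\<exists>us vs. xs = us @ vs \<and> (vs = [] \<or> fst (hd vs) = Minus) \<and>
     sign_count Minus (reduce xs) + sign_count Plus vs = sign_count Minus vs"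
proof (induction xs)
  case (Cons x xs)
  then obtain us vs where IH: "xs = us @ vs" "vs = [] \<or> fst (hd vs) = Minus"
     "sign_count Minus (reduce xs) + sign_count Plus vs = sign_count Minus vs" by blast
  show ?case
  proof (cases "sign_count Minus (reduce (x # xs)) = sign_count Minus (reduce xs)")
    case True
    then show ?thesis using IH by (intro exI[of _ "x # us"] exI[of _ vs]) (simp del: foldr.simps)
  next
    case False
    have x: "fst x = Minus" using False push_Plus[of x "reduce xs"] by (cases "fst x") auto
    then have "sign_count Plus (reduce (x # xs)) = 0"
      using False reduce_hd_Minus[of xs]
      by (auto simp: push_Minus sgn_neq split: list.splits if_splits)
    then show ?thesis
      using sign_count_reduce_balance[of "x # xs"] x
      by (intro exI[of _ "[]"] exI[of _ "x # xs"]) simp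
  qed
qed simp

text \<open>The slack \<open>t\<close> varies in the induction: a leading plus uses up one unit of
  it and a leading minus supplies one.\<close>

lemma reduce_Plus_le:
  assumes "\<And>ys zs. xs = ys @ zs \<Longrightarrow> sign_count Plus ys \<le> sign_count Minus ys + t"
  shows "sign_count Plus (reduce xs) \<le> t"
  using assms
proof (induction xs arbitrary: t)
  case (Cons x xs)
  show ?case
  proof (cases "fst x")
    case Plus
    have "1 \<le> t" using Cons.prems[of "[x]" xs] Plus by simp
    have "sign_count Plus (reduce xs) \<le> t - 1"
    proof (rule Cons.IH)
      fix ys zs assume "xs = ys @ zs"
      then show "sign_count Plus ys \<le> sign_count Minus ys + (t - 1)"
        using Cons.prems[of "x # ys" zs] Plus by simp
    qed
    then show ?thesis using Plus \<open>1 \<le> t\<close> by (simp add: push_Plus)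
  next
    case Minus
    have "sign_count Plus (reduce xs) \<le> Suc t"
    proof (rule Cons.IH)
      fix ys zs assume "xs = ys @ zs"
      then show "sign_count Plus ys \<le> sign_count Minus ys + Suc t"
        using Cons.prems[of "x # ys" zs] Minus by simp
    qed
    \<comment> \<open>Either the minus cancels a plus, which brings the bound back to
      \<open>t\<close>, or the stack holds no plus at all.\<close>
    then show ?thesis using Minus reduce_hd_Minus[of xs]
      by (auto simp: push_Minus sgn_neq split: list.splits)
  qed
qed simp

text \<open>By \<open>reduce_Plus_le\<close> the word \<open>vs\<close> reduces to minus signs only,
  so the marked minus meets no plus when it is pushed. From then on it stays, since pushing deletes
  only plus signs.\<close>

lemma in_set_reduceI:
  assumes "\<And>ys zs. vs = ys @ zs \<Longrightarrow> sign_count Plus ys \<le> sign_count Minus ys"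
  shows "(Minus, a) \<in> set (reduce (us @ (Minus, a) # vs))"
proof (induction us)
  case Nil
  have "sign_count Plus (reduce vs) = 0" using reduce_Plus_le[of vs 0] assms by simp
  then show ?case by (auto simp: push_Minus split: list.splits)
next
  case (Cons x us)
  then show ?case
    by (cases "fst x = Plus") (auto simp: push_Plus push_Minus sgn_neq split: list.splits)
qed

subsection \<open>Nodes, ramps and residues\<close>

lemma partition_downD:
  assumes "is_partition D" "(r, c) \<in> D" "1 \<le> r'" "r' \<le> r" "1 \<le> c'" "c' \<le> c"
  shows "(r', c') \<in> D"
  using assms unfolding is_partition_iff by blast

lemma partition_finite: "is_partition D \<Longrightarrow> finite D"
  unfolding is_partition_iff by blast

lemma partition_nodes: "is_partition D \<Longrightarrow> (r, c) \<in> D \<Longrightarrow> 1 \<le> r \<and> 1 \<le> c"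
  unfolding is_partition_iff nodes_def by blast

lemma removable_iff:
  assumes D: "is_partition D"
  shows "removable D (r, c) \<longleftrightarrow> (r, c) \<in> D \<and> (r, Suc c) \<notin> D \<and> (Suc r, c) \<notin> D"
proof (intro iffI conjI)
  assume rem: "removable D (r, c)"
  then show rc: "(r, c) \<in> D" unfolding removable_def by blast
  have P: "is_partition (D - {(r, c)})" using rem unfolding removable_def by blast
  have 1: "1 \<le> r" "1 \<le> c" using partition_nodes[OF D rc] by auto
  show "(r, Suc c) \<notin> D" using partition_downD[OF P, of r "Suc c" r c] 1 by auto
  show "(Suc r, c) \<notin> D" using partition_downD[OF P, of "Suc r" c r c] 1 by auto
next
  assume R: "(r, c) \<in> D \<and> (r, Suc c) \<notin> D \<and> (Suc r, c) \<notin> D"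
  then have 1: "1 \<le> r" "1 \<le> c" using partition_nodes[OF D] by auto
  have "is_partition (D - {(r, c)})"
    unfolding is_partition_iff
  proof (intro conjI allI impI)
    fix a b a' b' assume ab: "(a, b) \<in> D - {(r, c)}" and le: "1 \<le> a'" "a' \<le> a" "1 \<le> b'" "b' \<le> b"
    have "(a', b') \<in> D" using partition_downD[OF D _ le] ab by blast
    moreover have "(a', b') \<noteq> (r, c)"
    proof
      assume eq: "(a', b') = (r, c)"
      \<comment> \<open>A node of \<open>D\<close> weakly below and to the right of
        \<open>(r, c)\<close>, and different from it, would force the node below or the node right
        of \<open>(r, c)\<close> into \<open>D\<close>.\<close>
      then have "Suc r \<le> a \<or> Suc c \<le> b" using le ab by (cases "a = r") auto
      then show False
        using partition_downD[OF D, of a b "Suc r" c] partition_downD[OF D, of a b r "Suc c"] R ab le eq 1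
        by auto
    qed
    ultimately show "(a', b') \<in> D - {(r, c)}" by blast
  qed (use D in \<open>auto simp: is_partition_iff\<close>)
  then show "removable D (r, c)" using R unfolding removable_def by blast
qed

lemma addable_iff:
  assumes D: "is_partition D"
  shows "addable D (r, c) \<longleftrightarrow> 1 \<le> r \<and> 1 \<le> c \<and> (r, c) \<notin> D \<and>
           (r = 1 \<or> (r - 1, c) \<in> D) \<and> (c = 1 \<or> (r, c - 1) \<in> D)" (is "_ \<longleftrightarrow> ?R")
proof
  assume add: "addable D (r, c)"
  then have 1: "1 \<le> r" "1 \<le> c" "(r, c) \<notin> D" unfolding addable_def nodes_def by auto
  have P: "is_partition (insert (r, c) D)" using add unfolding addable_def by blast
  have "(r - 1, c) \<in> D" if "r \<noteq> 1"
  proof -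
    have "(r - 1, c) \<in> insert (r, c) D"
      by (rule partition_downD[OF P, of r c]) (use 1 that in auto)
    then show ?thesis using 1 by auto
  qed
  moreover have "(r, c - 1) \<in> D" if "c \<noteq> 1"
  proof -
    have "(r, c - 1) \<in> insert (r, c) D"
      by (rule partition_downD[OF P, of r c]) (use 1 that in auto)
    then show ?thesis using 1 by auto
  qed
  ultimately show ?R using 1 by blast
next
  assume R: ?R
  have "is_partition (insert (r, c) D)"
    unfolding is_partition_iff
  proof (intro conjI allI impI)
    fix a b a' b' assume ab: "(a, b) \<in> insert (r, c) D" and le: "1 \<le> a'" "a' \<le> a" "1 \<le> b'" "b' \<le> b"
    show "(a', b') \<in> insert (r, c) D"
    proof (cases "(a, b) \<in> D \<or> (a', b') = (r, c)")
      case True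
      then show ?thesis using partition_downD[OF D _ le] by blast
    next
      case False
      then have eq: "a = r" "b = c" "a' \<noteq> r \<or> b' \<noteq> c" using ab by auto
      show ?thesis
      proof (cases "a' = r")
        case True
        then have "b' \<le> c - 1" "c \<noteq> 1" using eq le by auto
        then show ?thesis using partition_downD[OF D, of r "c - 1" a' b'] R le True by auto
      next
        case False
        then have "a' \<le> r - 1" "r \<noteq> 1" using eq le by auto
        then show ?thesis using partition_downD[OF D, of "r - 1" c a' b'] R le eq by auto
      qed
    qed
  qed (use D R in \<open>auto simp: is_partition_iff nodes_def\<close>)
  then show "addable D (r, c)" using R unfolding addable_def nodes_def by blast
qed

lemma removable_nodes_subset: "removable_nodes p i D \<subseteq> D"
  unfolding removable_nodes_def removable_def by blast

lemma finite_removable_nodes: "is_partition D \<Longrightarrow> finite (removable_nodes p i D)"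
  using removable_nodes_subset partition_finite finite_subset by metis

text \<open>An addable node other than \<open>(1, 1)\<close> is directly below or directly right of
  a node of \<open>D\<close>.\<close>

lemma finite_addable_nodes:
  assumes D: "is_partition D" shows "finite (addable_nodes p i D)"
proof (rule finite_subset)
  show "addable_nodes p i D \<subseteq>
    {(1, 1)} \<union> (\<lambda>(r, c). (Suc r, c)) ` D \<union> (\<lambda>(r, c). (r, Suc c)) ` D"
  proof
    fix n assume "n \<in> addable_nodes p i D"
    then obtain r c where n: "n = (r, c)" and "addable D (r, c)"
      unfolding addable_nodes_def by (cases n) auto
    then have R: "1 \<le> r" "1 \<le> c" "r = 1 \<or> (r - 1, c) \<in> D" "c = 1 \<or> (r, c - 1) \<in> D"
      using addable_iff[OF D] by auto
    then show "n \<in> {(1, 1)} \<union> (\<lambda>(r, c). (Suc r, c)) ` D \<union> (\<lambda>(r, c). (r, Suc c)) ` D"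
      unfolding n using image_eqI[of "(r, c)" "\<lambda>(r, c). (Suc r, c)" "(r - 1, c)" D]
       image_eqI[of "(r, c)" "\<lambda>(r, c). (r, Suc c)" "(r, c - 1)" D] by auto
  qed
qed (use partition_finite[OF D] in simp)

text \<open>The nodes may be removed all at once: each of them is removable by itself, so none lies
  above and to the left of a node that stays.\<close>

lemma is_partition_remove_removable:
  assumes D: "is_partition D"
  shows "is_partition (remove_removable p i D)"
  unfolding is_partition_iff
proof (intro conjI allI impI)
  show "finite (remove_removable p i D)" "remove_removable p i D \<subseteq> nodes"
    using D unfolding remove_removable_def is_partition_iff by blast+
next
  fix r c r' c' assume rc: "(r, c) \<in> remove_removable p i D" 
    and le: "1 \<le> r'" "r' \<le> r" "1 \<le> c'" "c' \<le> c"
  then have "(r', c') \<in> D" using partition_downD[OF D] unfolding remove_removable_def by blast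
  moreover have "(r', c') \<notin> removable_nodes p i D"
  proof
    assume R: "(r', c') \<in> removable_nodes p i D"
    then have "is_partition (D - {(r', c')})" unfolding removable_nodes_def removable_def by blast
    moreover have "(r, c) \<in> D - {(r', c')}" using rc R unfolding remove_removable_def by blast
    ultimately show False using partition_downD le by blast
  qed
  ultimately show "(r', c') \<in> remove_removable p i D" unfolding remove_removable_def by blast
qed

section \<open>Arithmetic of ramp indices\<close>

lemma ramp_iff: "(r, c) \<in> ramp p l \<longleftrightarrow> 1 \<le> r \<and> 1 \<le> c \<and> ramp_index p (r, c) = l"
  unfolding ramp_def nodes_def by auto

lemma ramp_index_Suc: "ramp_index p (Suc r, Suc c) = c + (p - 1) * r"
  by (simp add: ramp_index_def)

lemma ramp_index_right: "1 \<le> c \<Longrightarrow> ramp_index p (r, Suc c) = Suc (ramp_index p (r, c))"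
  by (simp add: ramp_index_def)

lemma ramp_index_down: "1 \<le> r \<Longrightarrow> ramp_index p (Suc r, c) = ramp_index p (r, c) + (p - 1)"
  by (cases r) (simp_all add: ramp_index_def)

lemma finite_ramp: "2 \<le> p \<Longrightarrow> finite (ramp p l)"
proof (rule finite_subset[of _ "{..Suc l} \<times> {..Suc l}"])
  assume p: "2 \<le> p"
  show "ramp p l \<subseteq> {..Suc l} \<times> {..Suc l}"
  proof
    fix n assume n: "n \<in> ramp p l"
    obtain r c where rc: "n = (r, c)" by (cases n)
    have "1 * (r - 1) \<le> (p - 1) * (r - 1)" using p by (intro mult_right_mono) auto
    moreover have "c - 1 + (p - 1) * (r - 1) = l"
      using n unfolding rc ramp_iff ramp_index_def fst_conv snd_conv by blast
    ultimately have "r \<le> Suc l" "c \<le> Suc l" by linarith+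
    then show "n \<in> {..Suc l} \<times> {..Suc l}" unfolding rc by simp
  qed
qed simp

text \<open>The ramp index of \<open>(r, c)\<close> is \<open>c - r\<close> plus the multiple
  \<open>(r - 1) * p\<close> of \<open>p\<close>.\<close>

lemma residue_eq_iff:
  assumes "(r, c) \<in> ramp p l" "i < p"
  shows "residue p (r, c) = int i \<longleftrightarrow> l mod p = i"
proof -
  obtain a b where ab: "r = Suc a" "c = Suc b" using assms(1) unfolding ramp_iff by (cases r; cases c) auto
  have "int l = int b + (int p - 1) * int a"
    using assms unfolding ramp_iff ab ramp_index_Suc by (auto simp: of_nat_diff)
  also have "\<dots> = int c - int r + int a * int p" unfolding ab by (simp add: algebra_simps)
  finally have "residue p (r, c) = int (l mod p)"
    unfolding residue_def by (simp add: zmod_int)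
  then show ?thesis by simp
qed

lemma ramp_eq_row_less:
  assumes "2 \<le> p" "(r, c) \<in> ramp p l" "(r', c') \<in> ramp p l"
  shows "c' < c \<longleftrightarrow> r < r'"
proof -
  have "r - 1 < r' - 1 \<longleftrightarrow> (p - 1) * (r - 1) < (p - 1) * (r' - 1)" using assms(1) by simp
  moreover have "1 \<le> r" "1 \<le> r'" "1 \<le> c" "1 \<le> c'"
    "c - 1 + (p - 1) * (r - 1) = c' - 1 + (p - 1) * (r' - 1)"
    using assms unfolding ramp_iff ramp_index_def by auto
  ultimately show ?thesis by linarith
qed

section \<open>Restrictisation, one ramp at a time\<close>

lemma restrictisation_iff:
  assumes "n \<in> ramp p l"
  shows "n \<in> restrictisation p D \<longleftrightarrow> card {m \<in> ramp p l. snd m < snd n} < card (D \<inter> ramp p l)"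
  using assms unfolding restrictisation_def ramp_def by auto

lemma restrictisation_left:
  assumes "2 \<le> p" "m \<in> restrictisation p D" "m \<in> ramp p l" "n \<in> ramp p l" "snd n \<le> snd m"
  shows "n \<in> restrictisation p D"
proof -
  have "card {x \<in> ramp p l. snd x < snd n} \<le> card {x \<in> ramp p l. snd x < snd m}"
    using assms finite_ramp by (intro card_mono) auto
  then show ?thesis using assms(2) restrictisation_iff[OF assms(3)] restrictisation_iff[OF assms(4)]
    by (simp add: le_less_trans)
qed

lemma restrictisation_mono:
  assumes "2 \<le> p" "D \<subseteq> E"
  shows "restrictisation p D \<subseteq> restrictisation p E"
proof
  fix n assume n: "n \<in> restrictisation p D"
  then obtain l where l: "n \<in> ramp p l" unfolding restrictisation_def by blast
  have "card (D \<inter> ramp p l) \<le> card (E \<inter> ramp p l)"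
    using assms finite_ramp by (intro card_mono) auto
  then show "n \<in> restrictisation p E" using n l by (simp add: restrictisation_iff)
qed

subsection \<open>Balance of removable and addable nodes\<close>

text \<open>Adding row 0 and column 0 makes the tests for addable and removable nodes uniform: both
  become conditions on the corners of a 2 x 2 square, also at the edge of the diagram.\<close>

definition bordered :: "node set \<Rightarrow> node set" where
  "bordered D = D \<union> {(r, c). r = 0 \<or> c = 0}"

text \<open>The equation of ramp \<open>l\<close> with the subtractions cleared, so that it also
  makes sense in row 0 and column 0.\<close>

definition bordered_ramp :: "nat \<Rightarrow> nat \<Rightarrow> node set" where
  "bordered_ramp p l = {(r, c). c + (p - 1) * r = l + p}"

lemma finite_bordered_ramp:
  assumes "2 \<le> p" shows "finite (bordered_ramp p l)"
proof (rule finite_subset[of _ "{..l + p} \<times> {..l + p}"])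
  show "bordered_ramp p l \<subseteq> {..l + p} \<times> {..l + p}"
  proof
    fix n assume n: "n \<in> bordered_ramp p l"
    obtain r c where rc: "n = (r, c)" by (cases n)
    have "1 * r \<le> (p - 1) * r" using assms by (intro mult_right_mono) auto
    moreover have "c + (p - 1) * r = l + p"
      using n unfolding rc bordered_ramp_def mem_Collect_eq prod.case .
    ultimately have "r \<le> l + p" "c \<le> l + p" by linarith+
    then show "n \<in> {..l + p} \<times> {..l + p}" unfolding rc by simp
  qed
qed simp

text \<open>For squares whose upper left corner is in the bordered ramp \<open>l\<close>, the
  corners away from the border lie in the ramps \<open>l\<close>, \<open>l + 1\<close>,
  \<open>l + (p - 1)\<close> and \<open>l + p\<close>.\<close>

lemma shift_bordered_ramp:
  assumes "2 \<le> p" "u \<le> 1" "v \<le> 1"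
  shows "(r, c) \<in> bordered_ramp p l \<and> 1 \<le> r + u \<and> 1 \<le> c + v \<longleftrightarrow>
    (r + u, c + v) \<in> ramp p (l + v + (p - 1) * u)"
proof -
  obtain q where q: "p = Suc q" using assms(1) by (cases p) auto
  have uv: "u = 0 \<or> u = 1" "v = 0 \<or> v = 1" using assms by auto
  show ?thesis
  proof (cases "1 \<le> r + u \<and> 1 \<le> c + v")
    case True
    then obtain a b where ab: "r + u = Suc a" "c + v = Suc b" by (cases "r + u"; cases "c + v") auto
    have "b + q * a = l + v + q * u \<longleftrightarrow> c + q * r = l + Suc q"
      using uv ab by auto
    then show ?thesis using ab unfolding ramp_iff ab ramp_index_Suc bordered_ramp_def q by simp
  qed (auto simp: ramp_iff)
qed

text \<open>The last summand counts the corners on the border and is independent of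
  \<open>D\<close>. Hence the corner counts depend on \<open>D\<close> only through the sizes of its
  intersections with ramps.\<close>

lemma card_shifted_bordered_ramp:
  assumes p: "2 \<le> p" and D: "is_partition D" and uv: "u \<le> 1" "v \<le> 1"
  shows "card {n \<in> bordered_ramp p l. (fst n + u, snd n + v) \<in> bordered D} =
    card (D \<inter> ramp p (l + v + (p - 1) * u)) +
    card {n \<in> bordered_ramp p l. fst n + u = 0 \<or> snd n + v = 0}"
proof -
  let ?f = "\<lambda>n. (fst n + u, snd n + v)"
  let ?A = "{n \<in> bordered_ramp p l. ?f n \<in> D}"
  let ?B = "{n \<in> bordered_ramp p l. fst n + u = 0 \<or> snd n + v = 0}"
  have D0: "1 \<le> fst n \<and> 1 \<le> snd n" if "n \<in> D" for n
    using partition_nodes[OF D, of "fst n" "snd n"] that by simp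
  have "bij_betw ?f ?A (D \<inter> ramp p (l + v + (p - 1) * u))"
  proof (rule bij_betwI')
    fix n assume "n \<in> ?A"
    then have n: "n \<in> bordered_ramp p l" "?f n \<in> D" by auto
    then show "?f n \<in> D \<inter> ramp p (l + v + (p - 1) * u)"
      using shift_bordered_ramp[OF p uv, of "fst n" "snd n" l] D0[OF n(2)] by simp
  next
    fix m assume "m \<in> D \<inter> ramp p (l + v + (p - 1) * u)"
    then have m: "m \<in> D" "m \<in> ramp p (l + v + (p - 1) * u)" by auto
    define n where "n = (fst m - u, snd m - v)"
    have fn: "?f n = m" using D0[OF m(1)] uv unfolding n_def by (cases m) auto
    then have "n \<in> ?A"
      using shift_bordered_ramp[OF p uv, of "fst n" "snd n" l] m by simp
    with fn show "\<exists>n\<in>?A. m = ?f n" by (intro bexI[of _ n]) auto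
  qed (auto simp: prod_eq_iff)
  then have "card ?A = card (D \<inter> ramp p (l + v + (p - 1) * u))" by (rule bij_betw_same_card)
  moreover have "card (?A \<union> ?B) = card ?A + card ?B"
  proof (rule card_Un_disjoint)
    show "?A \<inter> ?B = {}" using D0 by fastforce
  qed (use finite_bordered_ramp[OF p] in auto)
  moreover have "{n \<in> bordered_ramp p l. ?f n \<in> bordered D} = ?A \<union> ?B"
    unfolding bordered_def by auto
  ultimately show ?thesis by simp
qed

lemma sum_of_bool_card: "finite X \<Longrightarrow> (\<Sum>x\<in>X. of_bool (P x)) = card {x \<in> X. P x}"
  by (simp add: of_bool_def sum.If_cases Int_def)

text \<open>In each square of the bordered diagram, the alternating sum of the four membership
  indicators is 1 if its upper left node is removable, -1 if its lower right node is addable,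
  and 0 otherwise.\<close>

lemma bordered_ramp_count:
  fixes p l :: nat and D :: "node set"
  assumes p: "2 \<le> p" and D: "is_partition D"
  defines "cnt u v \<equiv> card {n \<in> bordered_ramp p l. (fst n + u, snd n + v) \<in> bordered D}"
  shows "cnt 0 0 + cnt 1 1 + card {n \<in> ramp p (l + p). addable D n} =
    cnt 0 1 + cnt 1 0 + card {n \<in> ramp p l. removable D n}"
proof -
  let ?X = "bordered_ramp p l"
  let ?I = "\<lambda>u v n. (fst n + u, snd n + v) \<in> bordered D"
  let ?R = "\<lambda>n. ?I 0 0 n \<and> \<not> ?I 0 1 n \<and> \<not> ?I 1 0 n"
  let ?A = "\<lambda>n. ?I 0 1 n \<and> ?I 1 0 n \<and> \<not> ?I 1 1 n"
  have down: "(r', c') \<in> bordered D" if "(r, c) \<in> bordered D" "r' \<le> r" "c' \<le> c" for r c r' c'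
    using that partition_downD[OF D, of r c r' c'] unfolding bordered_def
    by (cases "r' = 0 \<or> c' = 0") auto
  have "of_bool (?I 0 0 n) + of_bool (?I 1 1 n) + of_bool (?A n) =
    of_bool (?I 0 1 n) + of_bool (?I 1 0 n) + (of_bool (?R n) :: nat)" for n
    using down[of "fst n" "snd n + 1" "fst n" "snd n"] down[of "fst n + 1" "snd n" "fst n" "snd n"]
      down[of "fst n + 1" "snd n + 1" "fst n" "snd n + 1"]
      down[of "fst n + 1" "snd n + 1" "fst n + 1" "snd n"] by (auto simp: of_bool_def)
  then have "(\<Sum>n\<in>?X. of_bool (?I 0 0 n) + of_bool (?I 1 1 n) + of_bool (?A n)) =
    (\<Sum>n\<in>?X. of_bool (?I 0 1 n) + of_bool (?I 1 0 n) + (of_bool (?R n) :: nat))"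
    by (intro sum.cong refl)
  then have "cnt 0 0 + cnt 1 1 + card {n \<in> ?X. ?A n} =
    cnt 0 1 + cnt 1 0 + card {n \<in> ?X. ?R n}"
    unfolding sum.distrib sum_of_bool_card[OF finite_bordered_ramp[OF p]] cnt_def .
  moreover have "{n \<in> ?X. ?R n} = {n \<in> ramp p l. removable D n}"
  proof -
    have "n \<in> ?X \<and> ?R n \<longleftrightarrow> n \<in> ramp p l \<and> removable D n" for n
    proof -
      obtain r c where n: "n = (r, c)" by (cases n)
      have "(r, c) \<in> ramp p l \<longleftrightarrow> (r, c) \<in> ?X \<and> 1 \<le> r \<and> 1 \<le> c"
        using shift_bordered_ramp[OF p, of 0 0 r c l] by simp
      moreover have "?R n \<longleftrightarrow> removable D n"
        using partition_nodes[OF D, of r c] unfolding n removable_iff[OF D] bordered_def by auto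
      moreover have "removable D n \<Longrightarrow> 1 \<le> r \<and> 1 \<le> c"
        using partition_nodes[OF D, of r c] unfolding n removable_iff[OF D] by blast
      ultimately show ?thesis unfolding n by blast
    qed
    then show ?thesis by blast
  qed
  \<comment> \<open>An addable node is the lower right corner of its square, hence the shift by
    \<open>(1, 1)\<close>, which raises the ramp index by \<open>p\<close>.\<close>
  moreover have "card {n \<in> ?X. ?A n} = card {n \<in> ramp p (l + p). addable D n}"
  proof (rule bij_betw_same_card[of "\<lambda>n. (Suc (fst n), Suc (snd n))"], rule bij_betwI')
    have X: "(r, c) \<in> ?X \<longleftrightarrow> (Suc r, Suc c) \<in> ramp p (l + p)" for r c
      using shift_bordered_ramp[OF p, of 1 1 r c l] p by simp
    have A: "?A (r, c) \<longleftrightarrow> addable D (Suc r, Suc c)" for r c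
      unfolding addable_iff[OF D] bordered_def by auto
    {
      fix n assume "n \<in> {n \<in> ?X. ?A n}"
      then show "(Suc (fst n), Suc (snd n)) \<in> {n \<in> ramp p (l + p). addable D n}"
        using X[of "fst n" "snd n"] A[of "fst n" "snd n"] by simp
    next
      fix m assume m: "m \<in> {n \<in> ramp p (l + p). addable D n}"
      then obtain r c where rc: "m = (Suc r, Suc c)"
        unfolding ramp_def nodes_def by (cases m; cases "fst m"; cases "snd m") auto
      then have "(r, c) \<in> {n \<in> ?X. ?A n}" using X[of r c] A[of r c] m by simp
      then show "\<exists>n\<in>{n \<in> ?X. ?A n}. m = (Suc (fst n), Suc (snd n))" unfolding rc by force
    }
  qed (auto simp: prod_eq_iff)
  ultimately show ?thesis by simp
qed

text \<open>The four corner counts agree for \<open>D\<close> and \<open>E\<close>, so they drop out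
  when the two instances of \<open>bordered_ramp_count\<close> are compared.\<close>

lemma ramp_balance:
  assumes "2 \<le> p" "is_partition D" "is_partition E"
    and "\<And>k. card (D \<inter> ramp p k) = card (E \<inter> ramp p k)"
  shows "card {n \<in> ramp p l. removable D n} + card {n \<in> ramp p (l + p). addable E n} =
    card {n \<in> ramp p l. removable E n} + card {n \<in> ramp p (l + p). addable D n}"
proof -
  have same: "card {n \<in> bordered_ramp p l. (fst n + u, snd n + v) \<in> bordered D} =
      card {n \<in> bordered_ramp p l. (fst n + u, snd n + v) \<in> bordered E}"
    if "u \<le> 1" "v \<le> 1" for u v
    unfolding card_shifted_bordered_ramp[OF assms(1,2) that]
      card_shifted_bordered_ramp[OF assms(1,3) that] assms(4) ..
  then show ?thesis
    using bordered_ramp_count[OF assms(1,2), of l] bordered_ramp_count[OF assms(1,3), of l]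
      same[OF le0 le0] same[OF le0 le_refl] same[OF le_refl le0] same[OF le_refl le_refl]
    by linarith
qed

section \<open>Summation over the ramps of one residue\<close>

lemma mod_eq_less_add_le:
  fixes x y p :: nat
  assumes "x mod p = y mod p" "x < y" shows "x + p \<le> y"
proof -
  obtain q where q: "y = x + p * q" using mod_eq_nat2E[of x p y] assms by auto
  then have "q \<noteq> 0" using assms(2) by (intro notI) simp
  then show ?thesis unfolding q by simp
qed

lemma residue_nodes_ramp_index:
  assumes "is_partition D" "i < p" "n \<in> addable_nodes p i D \<union> removable_nodes p i D"
  shows "n \<in> nodes" "ramp_index p n mod p = i"
proof -
  show nn: "n \<in> nodes" using assms
    unfolding addable_nodes_def addable_def removable_nodes_def removable_def is_partition_iff by blast
  then have "(fst n, snd n) \<in> ramp p (ramp_index p n)" unfolding ramp_def by simp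
  then show "ramp_index p n mod p = i"
    using residue_eq_iff[OF _ assms(2), of "fst n" "snd n"] assms(3)
    unfolding addable_nodes_def removable_nodes_def by auto
qed

lemma removable_nodes_on_ramp:
  assumes "is_partition D" "i < p"
  shows "{n \<in> removable_nodes p i D. ramp_index p n = l} =
      (if l mod p = i then {n \<in> ramp p l. removable D n} else {})"
proof -
  have "removable D n \<Longrightarrow> n \<in> nodes" for n
    using assms(1) unfolding removable_def is_partition_iff by blast
  moreover have "n \<in> ramp p l \<Longrightarrow> residue p n = int i \<longleftrightarrow> l mod p = i" for n
    using residue_eq_iff[of "fst n" "snd n" p l i] assms(2) by simp
  ultimately show ?thesis unfolding removable_nodes_def ramp_def by auto
qed

lemma addable_nodes_on_ramp:
  assumes "i < p"
  shows "{n \<in> addable_nodes p i D. ramp_index p n = l} =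
      (if l mod p = i then {n \<in> ramp p l. addable D n} else {})"
proof -
  have "addable D n \<Longrightarrow> n \<in> nodes" for n unfolding addable_def by blast
  moreover have "n \<in> ramp p l \<Longrightarrow> residue p n = int i \<longleftrightarrow> l mod p = i" for n
    using residue_eq_iff[of "fst n" "snd n" p l i] assms by simp
  ultimately show ?thesis unfolding addable_nodes_def ramp_def by auto
qed

lemma card_eq_sum_fibres:
  assumes "finite A" "finite K"
  shows "card {n \<in> A. f n \<in> K} = (\<Sum>j\<in>K. card {n \<in> A. f n = j})"
proof -
  have "{n \<in> A. f n \<in> K} = (\<Union>j\<in>K. {n \<in> A. f n = j})" by blast
  moreover have "card (\<Union>j\<in>K. {n \<in> A. f n = j}) = (\<Sum>j\<in>K. card {n \<in> A. f n = j})"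
    using assms by (intro card_UN_disjoint) auto
  ultimately show ?thesis by simp
qed

text \<open>The sum of \<open>ramp_balance\<close> over the ramps from \<open>k\<close> up to, but
  excluding, \<open>m\<close>.\<close>

lemma interval_balance:
  assumes p: "2 \<le> p" and D: "is_partition D" and E: "is_partition E"
    and eq: "\<And>k. card (D \<inter> ramp p k) = card (E \<inter> ramp p k)"
    and i: "i < p" "k mod p = i" "m mod p = i"
  shows "card {n \<in> removable_nodes p i D. k \<le> ramp_index p n \<and> ramp_index p n < m} +
      card {n \<in> addable_nodes p i E. k < ramp_index p n \<and> ramp_index p n \<le> m} =
    card {n \<in> removable_nodes p i E. k \<le> ramp_index p n \<and> ramp_index p n < m} +
      card {n \<in> addable_nodes p i D. k < ramp_index p n \<and> ramp_index p n \<le> m}"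
proof -
  let ?R = "\<lambda>D j. {n \<in> removable_nodes p i D. ramp_index p n = j}"
  let ?A = "\<lambda>D j. {n \<in> addable_nodes p i D. ramp_index p n = j}"
  have R: "card {n \<in> removable_nodes p i D. k \<le> ramp_index p n \<and> ramp_index p n < m} =
      (\<Sum>j=k..<m. card (?R D j))" if "is_partition D" for D
    using card_eq_sum_fibres[OF finite_removable_nodes[OF that, of p i], of "{k..<m}" "ramp_index p"]
    by simp
  have A: "card {n \<in> addable_nodes p i D. k < ramp_index p n \<and> ramp_index p n \<le> m} =
      (\<Sum>j=k..<m. card (?A D (j + p)))" if P: "is_partition D" for D
  proof -
    \<comment> \<open>The ramp indices of addable \<open>i\<close>-nodes are congruent to
      \<open>k\<close> and \<open>m\<close> modulo \<open>p\<close>, so none lies strictly between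
      \<open>k\<close> and \<open>k + p\<close> or between \<open>m\<close> and
      \<open>m + p\<close>.\<close>
    have "{n \<in> addable_nodes p i D. k < ramp_index p n \<and> ramp_index p n \<le> m} =
      {n \<in> addable_nodes p i D. ramp_index p n \<in> {k + p..<m + p}}"
    proof (intro Collect_cong conj_cong refl)
      fix n assume "n \<in> addable_nodes p i D"
      then have "ramp_index p n mod p = i" using residue_nodes_ramp_index[OF P i(1), of n] by blast
      then have "k < ramp_index p n \<Longrightarrow> k + p \<le> ramp_index p n"
        "m < ramp_index p n \<Longrightarrow> m + p \<le> ramp_index p n"
        using i by (simp_all add: mod_eq_less_add_le)
      then show "k < ramp_index p n \<and> ramp_index p n \<le> m \<longleftrightarrow> ramp_index p n \<in> {k + p..<m + p}"
        using p by (auto simp: not_le[symmetric])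
    qed
    also have "card \<dots> = (\<Sum>j=k + p..<m + p. card (?A D j))"
      using finite_addable_nodes[OF P] by (intro card_eq_sum_fibres) auto
    also have "\<dots> = (\<Sum>j=k..<m. card (?A D (j + p)))" by (rule sum.shift_bounds_nat_ivl)
    finally show ?thesis .
  qed
  have "card (?R D j) + card (?A E (j + p)) = card (?R E j) + card (?A D (j + p))" for j
    unfolding removable_nodes_on_ramp[OF D i(1)] removable_nodes_on_ramp[OF E i(1)]
      addable_nodes_on_ramp[OF i(1)]
    using ramp_balance[OF p D E eq, of j] by simp
  then show ?thesis unfolding R[OF D] R[OF E] A[OF D] A[OF E] sum.distrib[symmetric] by simp
qed

subsection \<open>The signature of a restrictisation\<close>

lemma removable_disjoint_addable: "removable_nodes p i D \<inter> addable_nodes p i D = {}"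
  unfolding removable_nodes_def removable_def addable_nodes_def addable_def by blast

lemma addable_removable_row:
  assumes D: "is_partition D" and n: "(r, c) \<in> addable_nodes p i D \<union> removable_nodes p i D"
  shows "(r, Suc c) \<notin> D" and "c = 1 \<or> (r, c - 1) \<in> D"
proof -
  have "addable D (r, c) \<or> removable D (r, c)"
    using n unfolding addable_nodes_def removable_nodes_def by blast
  then have *: "(r, Suc c) \<notin> D \<and> (c = 1 \<or> (r, c - 1) \<in> D)"
  proof
    assume "addable D (r, c)"
    then show ?thesis using partition_downD[OF D, of r "Suc c" r c] unfolding addable_iff[OF D] by auto
  next
    assume rem: "removable D (r, c)"
    then have "(r, c) \<in> D" "(r, Suc c) \<notin> D" unfolding removable_iff[OF D] by auto
    moreover from this have "1 \<le> r" "1 \<le> c" using partition_nodes[OF D] by auto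
    moreover have "(r, c - 1) \<in> D" if "c \<noteq> 1"
      by (rule partition_downD[OF D \<open>(r, c) \<in> D\<close>]) (use \<open>1 \<le> r\<close> \<open>1 \<le> c\<close> that in auto)
    ultimately show ?thesis by blast
  qed
  then show "(r, Suc c) \<notin> D" "c = 1 \<or> (r, c - 1) \<in> D" by blast+
qed

text \<open>Such a node is in the last column of its row or in the next one. Two of them in one row
  would have consecutive ramp indices, which are not congruent modulo \<open>p\<close>.\<close>

lemma inj_on_fst_signature_nodes:
  assumes p: "2 \<le> p" and i: "i < p" and D: "is_partition D"
  shows "inj_on fst (addable_nodes p i D \<union> removable_nodes p i D)" (is "inj_on fst ?T")
proof -
  have False if "(r, c) \<in> ?T" "(r, c') \<in> ?T" "c < c'" for r c c'
  proof -
    have rc: "(r, Suc c) \<notin> D" "c' = 1 \<or> (r, c' - 1) \<in> D"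
      using addable_removable_row[OF D that(1)] addable_removable_row[OF D that(2)] by blast+
    have pos: "1 \<le> r" "1 \<le> c" 
      using residue_nodes_ramp_index(1)[OF D i that(1)] by (auto simp: nodes_def)
    have "c' = Suc c"
    proof (rule ccontr)
      assume "c' \<noteq> Suc c"
      then have "(r, c' - 1) \<in> D" "Suc c \<le> c' - 1" using rc that(3) pos by auto
      then show False using partition_downD[OF D, of r "c' - 1" r "Suc c"] rc(1) pos by simp
    qed
    then have "ramp_index p (r, c') = ramp_index p (r, c) + 1"
      using ramp_index_right[OF pos(2)] by simp
    moreover have "ramp_index p (r, c') mod p = ramp_index p (r, c) mod p"
      using residue_nodes_ramp_index(2)[OF D i that(1)] residue_nodes_ramp_index(2)[OF D i that(2)]
      by simp
    ultimately show False
      using mod_eq_less_add_le[of "ramp_index p (r, c)" p "ramp_index p (r, c')"] p by simp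
  qed
  then show ?thesis unfolding inj_on_def by (metis linorder_neqE_nat prod.collapse)
qed

text \<open>Otherwise the index drops by at least \<open>p\<close> from \<open>m\<close> to
  \<open>n\<close>. The left neighbour of \<open>m\<close> is in \<open>E\<close>, and since
  \<open>E\<close> is pushed to the left in each ramp, so is the node of the same ramp in the row of
  \<open>n\<close>. That node lies to the right of \<open>n\<close>, where \<open>E\<close> has
  nothing.\<close>

lemma ramp_index_le_of_row_less:
  assumes p: "2 \<le> p" and i: "i < p" and D: "is_partition D"
  defines "E \<equiv> restrictisation p D"
  assumes m: "m \<in> addable_nodes p i E \<union> removable_nodes p i E"
    and n: "n \<in> addable_nodes p i E \<union> removable_nodes p i E" and less: "fst m < fst n"
  shows "ramp_index p m \<le> ramp_index p n"
proof (rule ccontr)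
  have E: "is_partition E" unfolding E_def by (rule is_partition_restrictisation[OF p D])
  obtain q where q: "p = Suc q" using p by (cases p) auto
  obtain a b where ab: "m = (Suc a, Suc b)"
    using residue_nodes_ramp_index(1)[OF E i m] unfolding nodes_def
    by (cases m; cases "fst m"; cases "snd m") auto
  obtain d where d: "fst n = Suc (a + Suc d)" 
    using less less_natE unfolding ab by (metis add_Suc add_Suc_right fst_conv less_iff_Suc_add)
  obtain c where n_eq: "n = (Suc (a + Suc d), Suc c)"
    using residue_nodes_ramp_index(1)[OF E i n] d unfolding nodes_def
    by (cases n; cases "snd n") auto
  assume "\<not> ramp_index p m \<le> ramp_index p n"
  then have "ramp_index p n + p \<le> ramp_index p m"
    using residue_nodes_ramp_index(2)[OF E i m] residue_nodes_ramp_index(2)[OF E i n]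
    by (intro mod_eq_less_add_le) auto
  then have "c + q * (a + Suc d) + Suc q \<le> b + q * a"
    unfolding ab n_eq ramp_index_Suc q by simp
  then have *: "c + q * Suc d + Suc q \<le> b" by (simp add: algebra_simps)
  \<comment> \<open>\<open>Suc e\<close> is the column in which the ramp of the left neighbour of
    \<open>m\<close> meets the row of \<open>n\<close>.\<close>
  define e where "e = b - 1 - q * Suc d"
  have e: "b = Suc (e + q * Suc d)" "Suc c \<le> e" using * p q unfolding e_def by linarith+
  have left: "(Suc a, b) \<in> E" using addable_removable_row(2)[OF E m[unfolded ab]] e by auto
  have "(Suc (a + Suc d), Suc e) \<in> E"
    unfolding E_def
  proof (rule restrictisation_left[OF p])
    show "(Suc a, b) \<in> restrictisation p D" using left unfolding E_def .
    show "(Suc a, b) \<in> ramp p (e + q * (a + Suc d))"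
      unfolding ramp_iff e ramp_index_Suc q by (simp add: algebra_simps)
    show "(Suc (a + Suc d), Suc e) \<in> ramp p (e + q * (a + Suc d))"
      unfolding ramp_iff ramp_index_Suc q by simp
    show "snd (Suc (a + Suc d), Suc e) \<le> snd (Suc a, b)" unfolding e by simp
  qed
  then have "(Suc (a + Suc d), Suc (Suc c)) \<in> E"
    by (rule partition_downD[OF E]) (use e(2) in auto)
  then show False using addable_removable_row(1)[OF E n[unfolded n_eq]] by blast
qed

lemma row_less_of_ramp_index_less:
  assumes p: "2 \<le> p" and i: "i < p" and D: "is_partition D"
  defines "E \<equiv> restrictisation p D"
  assumes m: "m \<in> addable_nodes p i E \<union> removable_nodes p i E"
    and n: "n \<in> addable_nodes p i E \<union> removable_nodes p i E"
    and less: "ramp_index p m < ramp_index p n"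
  shows "fst m < fst n"
proof (rule ccontr)
  assume "\<not> fst m < fst n"
  then consider "fst n < fst m" | "fst m = fst n" by linarith
  then show False
  proof cases
    case 1
    then show ?thesis
      using ramp_index_le_of_row_less[OF p i D n[unfolded E_def] m[unfolded E_def]] less by simp
  next
    case 2
    have "is_partition E" unfolding E_def by (rule is_partition_restrictisation[OF p D])
    then have "m = n" using inj_onD[OF inj_on_fst_signature_nodes[OF p i] 2 m n] by blast
    then show ?thesis using less by simp
  qed
qed

text \<open>In each ramp \<open>E\<close> occupies the leftmost nodes, which are the lowest ones,
  and an addable node is outside \<open>E\<close>.\<close>

lemma addable_above_removable_in_ramp:
  assumes p: "2 \<le> p" and i: "i < p" and D: "is_partition D"
  defines "E \<equiv> restrictisation p D"
  assumes m: "m \<in> removable_nodes p i E" and n: "n \<in> addable_nodes p i E"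
    and eq: "ramp_index p m = ramp_index p n"
  shows "fst n < fst m"
proof (rule ccontr)
  assume neg: "\<not> fst n < fst m"
  have E: "is_partition E" unfolding E_def by (rule is_partition_restrictisation[OF p D])
  define l where "l = ramp_index p m"
  have ml: "m \<in> ramp p l" and nl: "n \<in> ramp p l"
    using residue_nodes_ramp_index(1)[OF E i] m n eq unfolding ramp_def l_def by auto
  have "\<not> snd m < snd n" using ramp_eq_row_less[OF p, of "fst n" "snd n" l "fst m" "snd m"] ml nl neg
    by simp
  then have "n \<in> E" using restrictisation_left[OF p _ ml nl] m 
    unfolding E_def removable_nodes_def removable_def by simp
  then show False using n unfolding addable_nodes_def addable_def by blast
qed

section \<open>The signature as a list of nodes sorted by row\<close>

lemma (in linorder) sorted_key_list_of_set_inj: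
  assumes "inj_on f S" "finite S"
  shows "set (sorted_key_list_of_set f S) = S"
    and "sorted_wrt (<) (map f (sorted_key_list_of_set f S))"
proof -
  interpret folding_insort_key "(\<le>)" "(<)" S f
    by unfold_locales (rule assms(1))
  show "set (sorted_key_list_of_set f S) = S"
    by (rule set_sorted_key_list_of_set[OF subset_refl assms(2)])
  show "sorted_wrt (<) (map f (sorted_key_list_of_set f S))"
    by (rule strict_sorted_key_list_of_set[OF subset_refl])
qed

lemma signature_obtain:
  assumes p: "2 \<le> p" and i: "i < p" and D: "is_partition D"
  obtains ns where
    "signature p i D = map (\<lambda>n. (if n \<in> addable_nodes p i D then Plus else Minus, n)) ns"
    "set ns = addable_nodes p i D \<union> removable_nodes p i D"
    "sorted_wrt (\<lambda>m n. fst m < fst n) ns"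
proof
  let ?T = "addable_nodes p i D \<union> removable_nodes p i D"
  let ?ns = "sorted_key_list_of_set fst ?T"
  have fin: "finite ?T" using finite_addable_nodes[OF D] finite_removable_nodes[OF D] by blast
  show "signature p i D = map (\<lambda>n. (if n \<in> addable_nodes p i D then Plus else Minus, n)) ?ns"
    unfolding signature_def ..
  show "set ?ns = ?T"
    by (rule sorted_key_list_of_set_inj(1)[OF inj_on_fst_signature_nodes[OF assms] fin])
  show "sorted_wrt (\<lambda>m n. fst m < fst n) ?ns"
    using sorted_key_list_of_set_inj(2)[OF inj_on_fst_signature_nodes[OF assms] fin]
    by (simp add: sorted_wrt_map)
qed

lemma sign_count_map:
  assumes "set ns \<subseteq> addable_nodes p i D \<union> removable_nodes p i D" "distinct ns"
  defines "f \<equiv> \<lambda>n. (if n \<in> addable_nodes p i D then Plus else Minus, n)"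
  shows "sign_count Plus (map f ns) = card (set ns \<inter> addable_nodes p i D)"
    and "sign_count Minus (map f ns) = card (set ns \<inter> removable_nodes p i D)"
proof -
  have "sign_count s (map f ns) = card {n \<in> set ns. fst (f n) = s}" for s
    unfolding sign_count_def filter_map length_map using assms(2)
    by (subst distinct_length_filter) (auto intro: arg_cong[where f = card])
  moreover have "{n \<in> set ns. fst (f n) = Plus} = set ns \<inter> addable_nodes p i D"
    "{n \<in> set ns. fst (f n) = Minus} = set ns \<inter> removable_nodes p i D"
    using assms(1) removable_disjoint_addable[of p i D] unfolding f_def by (auto split: if_splits)
  ultimately show "sign_count Plus (map f ns) = card (set ns \<inter> addable_nodes p i D)"
    and "sign_count Minus (map f ns) = card (set ns \<inter> removable_nodes p i D)" by simp_all
qed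

subsection \<open>Bounding the number of normal nodes\<close>

lemma nor_le_sign_count: "nor p i D \<le> sign_count Minus (reduce (signature p i D))"
proof -
  let ?xs = "filter (\<lambda>x. fst x = Minus) (reduce (signature p i D))"
  have "normal_nodes p i D \<subseteq> set (map snd ?xs)"
    unfolding normal_nodes_def reduced_signature_eq_reduce by force
  then have "nor p i D \<le> card (set (map snd ?xs))"
    unfolding nor_def by (intro card_mono) auto
  also have "\<dots> \<le> length (map snd ?xs)" by (rule card_length)
  finally show ?thesis unfolding sign_count_def by simp
qed

lemma finite_normal_nodes: "finite (normal_nodes p i D)"
proof (rule finite_subset)
  show "normal_nodes p i D \<subseteq> set (map snd (reduced_signature p i D))"
    unfolding normal_nodes_def by force
qed simp

text \<open>Here \<open>k\<close> is the ramp of the first node of the suffix from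
  \<open>reduce_extremal_suffix\<close>; the suffix is nonempty as there are normal nodes. It
  contains all signature nodes in ramps after \<open>k\<close> and none in ramps before
  \<open>k\<close>, so its excess is bounded by counts over ramps of \<open>E\<close>, and
  \<open>interval_balance\<close> turns these into counts for \<open>D\<close>.\<close>

lemma nor_restrictisation_bound:
  assumes p: "2 \<le> p" and i: "i < p" and D: "is_partition D"
  defines "E \<equiv> restrictisation p D"
  assumes nor: "nor p i E \<noteq> 0"
  obtains k where "nor p i E + card {n \<in> addable_nodes p i D. k < ramp_index p n} \<le>
    card {n \<in> removable_nodes p i D. k \<le> ramp_index p n}"
proof -
  let ?g = "\<lambda>n. (if n \<in> addable_nodes p i E then Plus else Minus, n)"
  have E: "is_partition E" unfolding E_def by (rule is_partition_restrictisation[OF p D])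
  obtain ns where ns: "signature p i E = map ?g ns"
      "set ns = addable_nodes p i E \<union> removable_nodes p i E"
      "sorted_wrt (\<lambda>m n. fst m < fst n) ns"
    by (rule signature_obtain[OF p i E])
  obtain us vs where uv: "signature p i E = us @ vs" "vs = [] \<or> fst (hd vs) = Minus"
     "sign_count Minus (reduce (signature p i E)) + sign_count Plus vs = sign_count Minus vs"
    using reduce_extremal_suffix[of "signature p i E"] by blast
  then have "vs \<noteq> []" using nor nor_le_sign_count[of p i E] by auto
  moreover obtain us' vs' where *: "ns = us' @ vs'" "vs = map ?g vs'"
    using uv(1) unfolding ns(1) map_eq_append_conv by blast
  ultimately obtain n ws where vs': "vs' = n # ws" by (cases vs') auto
  have n: "n \<in> removable_nodes p i E"
    using uv(2) ns(2) * vs' by (auto split: if_splits)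
  define k where "k = ramp_index p n"
  have dist: "distinct ns"
    using ns(3) by (simp add: strict_sorted_iff distinct_map flip: sorted_wrt_map[of "(<)" fst])
  have later: "m \<in> set vs' \<longleftrightarrow> fst n \<le> fst m" if "m \<in> addable_nodes p i E \<union> removable_nodes p i E" for m
    using that[folded ns(2)] ns(3) unfolding * vs' by (auto simp: sorted_wrt_append)
  have sub: "set vs' \<subseteq> addable_nodes p i E \<union> removable_nodes p i E" using ns(2) * by auto
  have "nor p i E + card (set vs' \<inter> addable_nodes p i E) \<le> card (set vs' \<inter> removable_nodes p i E)"
    using uv(3) nor_le_sign_count[of p i E] sign_count_map[OF sub] dist unfolding * by simp
  moreover have "card {m \<in> addable_nodes p i E. k < ramp_index p m} \<le> card (set vs' \<inter> addable_nodes p i E)"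
  proof (rule card_mono)
    show "{m \<in> addable_nodes p i E. k < ramp_index p m} \<subseteq> set vs' \<inter> addable_nodes p i E"
    proof
      fix m assume m: "m \<in> {m \<in> addable_nodes p i E. k < ramp_index p m}"
      then have "fst n < fst m"
        using row_less_of_ramp_index_less[OF p i D, folded E_def, of n m] n unfolding k_def by blast
      then show "m \<in> set vs' \<inter> addable_nodes p i E" using later[of m] m by auto
    qed
  qed simp
  moreover have "card (set vs' \<inter> removable_nodes p i E) \<le> card {m \<in> removable_nodes p i E. k \<le> ramp_index p m}"
  proof (rule card_mono)
    show "set vs' \<inter> removable_nodes p i E \<subseteq> {m \<in> removable_nodes p i E. k \<le> ramp_index p m}"
    proof
      fix m assume m: "m \<in> set vs' \<inter> removable_nodes p i E"
      then have "\<not> fst m < fst n" using later[of m] by auto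
      then have "\<not> ramp_index p m < ramp_index p n"
        using row_less_of_ramp_index_less[OF p i D, folded E_def, of m n] n m by blast
      then show "m \<in> {m \<in> removable_nodes p i E. k \<le> ramp_index p m}" using m unfolding k_def by auto
    qed
  qed (use finite_removable_nodes[OF E] in simp)
  moreover have "card {m \<in> removable_nodes p i E. k \<le> ramp_index p m} +
      card {m \<in> addable_nodes p i D. k < ramp_index p m} =
    card {m \<in> removable_nodes p i D. k \<le> ramp_index p m} +
      card {m \<in> addable_nodes p i E. k < ramp_index p m}"
  proof -
    let ?S = "addable_nodes p i E \<union> removable_nodes p i E \<union> addable_nodes p i D \<union> removable_nodes p i D"
    \<comment> \<open>All ramp indices involved are at most \<open>b\<close>, so the upper end
      \<open>k + p * Suc b\<close>, chosen congruent to \<open>k\<close>, cuts nothing off.\<close>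
    define b where "b = Max (ramp_index p ` ?S)"
    have "finite ?S" using finite_addable_nodes finite_removable_nodes D E by blast
    then have "ramp_index p m \<le> b" if "m \<in> ?S" for m unfolding b_def using that by (intro Max_ge) auto
    moreover have "1 * Suc b \<le> p * Suc b" using p by (intro mult_right_mono) auto
    then have "b < k + p * Suc b" unfolding mult_1 by (intro trans_less_add2 Suc_le_lessD)
    ultimately have b: "ramp_index p m < k + p * Suc b" if "m \<in> ?S" for m
      using le_less_trans that by blast
    have k: "k mod p = i" unfolding k_def using residue_nodes_ramp_index(2)[OF E i] n by blast
    have "(k + p * Suc b) mod p = i" using k by (simp only: mod_mult_self2)
    from interval_balance[OF p E D _ i k this] 
    have "card {m \<in> removable_nodes p i E. k \<le> ramp_index p m \<and> ramp_index p m < k + p * Suc b} +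
      card {m \<in> addable_nodes p i D. k < ramp_index p m \<and> ramp_index p m \<le> k + p * Suc b} =
    card {m \<in> removable_nodes p i D. k \<le> ramp_index p m \<and> ramp_index p m < k + p * Suc b} +
      card {m \<in> addable_nodes p i E. k < ramp_index p m \<and> ramp_index p m \<le> k + p * Suc b}"
      using card_restrictisation_ramp[OF p] unfolding E_def by blast
    moreover have "{m \<in> removable_nodes p i F. k \<le> ramp_index p m \<and> ramp_index p m < k + p * Suc b} =
        {m \<in> removable_nodes p i F. k \<le> ramp_index p m}"
      "{m \<in> addable_nodes p i F. k < ramp_index p m \<and> ramp_index p m \<le> k + p * Suc b} =
        {m \<in> addable_nodes p i F. k < ramp_index p m}" if "F \<in> {D, E}" for F
    proof -
      have "ramp_index p m < k + p * Suc b"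
        if "m \<in> addable_nodes p i F \<or> m \<in> removable_nodes p i F" for m
        using b[of m] that \<open>F \<in> {D, E}\<close> by (elim insertE disjE emptyE) simp_all
      then show "{m \<in> removable_nodes p i F. k \<le> ramp_index p m \<and> ramp_index p m < k + p * Suc b} =
          {m \<in> removable_nodes p i F. k \<le> ramp_index p m}"
        "{m \<in> addable_nodes p i F. k < ramp_index p m \<and> ramp_index p m \<le> k + p * Suc b} =
          {m \<in> addable_nodes p i F. k < ramp_index p m}"
        using less_imp_le by blast+
    qed
    ultimately show ?thesis by simp
  qed
  ultimately have "nor p i E + card {n \<in> addable_nodes p i D. k < ramp_index p n} \<le>
    card {n \<in> removable_nodes p i D. k \<le> ramp_index p n}" by linarith
  then show ?thesis by (rule that)
qed

text \<open>The right-hand side of \<open>nor_restrictisation_bound\<close> is at most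
  \<open>rem p i D\<close>. If equality holds, no addable \<open>i\<close>-node of \<open>D\<close>
  is in a ramp after \<open>k\<close> and no removable one is in a ramp before \<open>k\<close>, so
  \<open>k\<close> separates the two kinds.\<close>

lemma nor_restrictisation_le:
  assumes p: "2 \<le> p" and i: "i < p" and D: "is_partition D"
  shows "nor p i (restrictisation p D) \<le> rem p i D"
    and "nor p i (restrictisation p D) = rem p i D \<Longrightarrow> m \<in> removable_nodes p i D \<Longrightarrow>
      n \<in> addable_nodes p i D \<Longrightarrow> ramp_index p n \<le> ramp_index p m"
proof -
  let ?N = "nor p i (restrictisation p D)"
  note finR = finite_removable_nodes[OF D, of p i]
  note finA = finite_addable_nodes[OF D, of p i]
  have card_le: "card {n \<in> removable_nodes p i D. k \<le> ramp_index p n} \<le> rem p i D" for k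
    unfolding rem_def using finR by (intro card_mono) auto
  show "?N \<le> rem p i D"
  proof (cases "?N = 0")
    case False
    then obtain k where "?N + card {n \<in> addable_nodes p i D. k < ramp_index p n} \<le>
        card {n \<in> removable_nodes p i D. k \<le> ramp_index p n}"
      using nor_restrictisation_bound[OF p i D] by blast
    then show ?thesis using card_le[of k] by linarith
  qed simp
  assume eq: "?N = rem p i D" and m: "m \<in> removable_nodes p i D" and n: "n \<in> addable_nodes p i D"
  have "?N \<noteq> 0" unfolding eq rem_def using m finR by auto
  then obtain k where k: "?N + card {n \<in> addable_nodes p i D. k < ramp_index p n} \<le>
      card {n \<in> removable_nodes p i D. k \<le> ramp_index p n}"
    using nor_restrictisation_bound[OF p i D] by blast
  then have "card {n \<in> addable_nodes p i D. k < ramp_index p n} = 0"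
    and R: "card {n \<in> removable_nodes p i D. k \<le> ramp_index p n} = card (removable_nodes p i D)"
    using card_le[of k] unfolding eq rem_def by linarith+
  then have "{n \<in> addable_nodes p i D. k < ramp_index p n} = {}" using finA by (simp del: Collect_empty_eq)
  then have "\<not> k < ramp_index p n" using n by blast
  moreover have "{n \<in> removable_nodes p i D. k \<le> ramp_index p n} = removable_nodes p i D"
    by (rule card_subset_eq[OF finR _ R]) blast
  then have "k \<le> ramp_index p m" using m by blast
  ultimately show "ramp_index p n \<le> ramp_index p m" by linarith
qed

subsection \<open>The case of equality\<close>

lemma card_remove_removable_ramp:
  assumes "2 \<le> p" "is_partition D"
  shows "card (remove_removable p i D \<inter> ramp p l) +
    card {n \<in> removable_nodes p i D. ramp_index p n = l} = card (D \<inter> ramp p l)"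
proof -
  have "{n \<in> removable_nodes p i D. ramp_index p n = l} = D \<inter> ramp p l \<inter> removable_nodes p i D"
    using assms(2) removable_nodes_subset[of p i D] unfolding ramp_def is_partition_iff by blast
  moreover have "remove_removable p i D \<inter> ramp p l = D \<inter> ramp p l - removable_nodes p i D"
    unfolding remove_removable_def by blast
  ultimately show ?thesis
    using card_Int_Diff[of "D \<inter> ramp p l" "removable_nodes p i D"] finite_ramp[OF assms(1)] by simp
qed

section \<open>The nodes of \<open>E\<close> outside \<open>F\<close>\<close>

context
  fixes p i :: nat and D E F :: "node set"
  assumes p: "2 \<le> p" and i: "i < p" and D: "is_partition D"
  defines "E \<equiv> restrictisation p D"
    and "F \<equiv> restrictisation p (remove_removable p i D)"
begin

private lemma E: "is_partition E"
  unfolding E_def by (rule is_partition_restrictisation[OF p D])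

private lemma F: "is_partition F"
  unfolding F_def by (intro is_partition_restrictisation[OF p] is_partition_remove_removable D)

private lemma F_subset_E: "F \<subseteq> E"
  unfolding E_def F_def by (rule restrictisation_mono[OF p]) (auto simp: remove_removable_def)

text \<open>Restrictisation keeps the number of nodes in each ramp, so \<open>E\<close> loses as
  many nodes there as \<open>D\<close> does.\<close>

private lemma card_ramp_difference:
  "card ((E - F) \<inter> ramp p l) = card {n \<in> removable_nodes p i D. ramp_index p n = l}"
proof -
  have "card (E \<inter> ramp p l) = card (F \<inter> ramp p l) + card ((E - F) \<inter> ramp p l)"
  proof -
    have "E \<inter> ramp p l = (F \<inter> ramp p l) \<union> ((E - F) \<inter> ramp p l)" using F_subset_E by blast
    moreover have "card \<dots> = card (F \<inter> ramp p l) + card ((E - F) \<inter> ramp p l)"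
      using finite_ramp[OF p] by (intro card_Un_disjoint) auto
    ultimately show ?thesis by simp
  qed
  then show ?thesis
    using card_remove_removable_ramp[OF p D, of i l] card_restrictisation_ramp[OF p]
    unfolding E_def F_def by simp
qed

private lemma mem_ramp: "n \<in> E \<Longrightarrow> n \<in> ramp p (ramp_index p n)"
  using E unfolding is_partition_iff ramp_def by blast

private lemma difference_ramp_index:
  assumes "n \<in> E - F" shows "ramp_index p n mod p = i"
proof -
  let ?l = "ramp_index p n"
  have "n \<in> (E - F) \<inter> ramp p ?l" using assms mem_ramp by blast
  then have "card ((E - F) \<inter> ramp p ?l) \<noteq> 0" using finite_ramp[OF p] by auto
  then show ?thesis
    unfolding card_ramp_difference removable_nodes_on_ramp[OF D i] by (auto split: if_splits)
qed

text \<open>A right or lower neighbour in \<open>E\<close> would be outside \<open>F\<close>,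
  because \<open>F\<close> is a partition, so its ramp index would also have residue
  \<open>i\<close>. But the index changes by 1 or \<open>p - 1\<close>, and neither is a multiple of
  \<open>p\<close>.\<close>

private lemma difference_removable: "E - F \<subseteq> removable_nodes p i E"
proof
  fix n assume n: "n \<in> E - F"
  obtain r c where rc: "n = (r, c)" by (cases n)
  have 1: "1 \<le> r" "1 \<le> c" using partition_nodes[OF E] n unfolding rc by auto
  have ii: "ramp_index p (r, c) mod p = i" using difference_ramp_index[OF n] unfolding rc .
  have notF: "(r, Suc c) \<notin> F" "(Suc r, c) \<notin> F"
    using partition_downD[OF F, of r "Suc c" r c] partition_downD[OF F, of "Suc r" c r c] 1 n
    unfolding rc by auto
  have "(r, Suc c) \<notin> E"
  proof
    assume "(r, Suc c) \<in> E"
    then have "ramp_index p (r, Suc c) mod p = i" using difference_ramp_index notF by blast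
    then have "ramp_index p (r, c) mod p = Suc (ramp_index p (r, c)) mod p"
      using ii ramp_index_right[OF 1(2)] by simp
    then show False
      using mod_eq_less_add_le[of "ramp_index p (r, c)" p "Suc (ramp_index p (r, c))"] p by simp
  qed
  moreover have "(Suc r, c) \<notin> E"
  proof
    assume "(Suc r, c) \<in> E"
    then have "ramp_index p (Suc r, c) mod p = i" using difference_ramp_index notF by blast
    then have "ramp_index p (r, c) mod p = (ramp_index p (r, c) + (p - 1)) mod p"
      using ii ramp_index_down[OF 1(1)] by simp
    then have "ramp_index p (r, c) + p \<le> ramp_index p (r, c) + (p - 1)"
      using p by (intro mod_eq_less_add_le) simp_all
    then show False using p by simp
  qed
  ultimately have "removable E n" using n unfolding rc removable_iff[OF E] by blast
  moreover have "residue p n = int i"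
    using residue_eq_iff[of r c p "ramp_index p n" i] mem_ramp[of n] n i ii unfolding rc by blast
  ultimately show "n \<in> removable_nodes p i E" unfolding removable_nodes_def by blast
qed

text \<open>\<open>card_ramp_difference\<close> summed over all ramps that meet \<open>E\<close> or
  \<open>D\<close>.\<close>

private lemma card_difference: "card (E - F) = rem p i D"
proof -
  define b where "b = Max (ramp_index p ` (E \<union> D))"
  have "finite (E \<union> D)" using partition_finite D E by blast
  then have b: "ramp_index p n \<in> {..b}" if "n \<in> E \<union> D" for n
    unfolding b_def using that by simp
  have finE: "finite (E - F)" using partition_finite[OF E] by blast
  have "E - F = {n \<in> E - F. ramp_index p n \<in> {..b}}" using b by blast
  also have "card \<dots> = (\<Sum>l\<le>b. card {n \<in> E - F. ramp_index p n = l})"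
    by (rule card_eq_sum_fibres[OF finE]) simp
  also have "\<dots> = (\<Sum>l\<le>b. card {n \<in> removable_nodes p i D. ramp_index p n = l})"
  proof (intro sum.cong refl)
    fix l
    have "{n \<in> E - F. ramp_index p n = l} = (E - F) \<inter> ramp p l"
      using mem_ramp unfolding ramp_def by blast
    then show "card {n \<in> E - F. ramp_index p n = l} = card {n \<in> removable_nodes p i D. ramp_index p n = l}"
      by (simp only: card_ramp_difference)
  qed
  also have "\<dots> = card {n \<in> removable_nodes p i D. ramp_index p n \<in> {..b}}"
    by (rule card_eq_sum_fibres[symmetric]) (simp_all add: finite_removable_nodes[OF D])
  also have "{n \<in> removable_nodes p i D. ramp_index p n \<in> {..b}} = removable_nodes p i D"
    using b removable_nodes_subset by blast
  finally show ?thesis unfolding rem_def .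
qed

text \<open>The nodes counted on the left all lie in \<open>E - F\<close>.\<close>

private lemma card_above_le:
  assumes n: "n \<in> E - F"
  shows "card {m \<in> removable_nodes p i E. ramp_index p m = ramp_index p n \<and> fst m \<le> fst n}
    \<le> card {m \<in> removable_nodes p i D. ramp_index p m = ramp_index p n}"
proof -
  let ?l = "ramp_index p n"
  have "{m \<in> removable_nodes p i E. ramp_index p m = ?l \<and> fst m \<le> fst n} \<subseteq> (E - F) \<inter> ramp p ?l"
  proof
    fix m assume m: "m \<in> {m \<in> removable_nodes p i E. ramp_index p m = ?l \<and> fst m \<le> fst n}"
    then have mE: "m \<in> E" using removable_nodes_subset by blast
    have ml: "m \<in> ramp p ?l" and nl: "n \<in> ramp p ?l" using mem_ramp[OF mE] mem_ramp[of n] n m by auto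
    \<comment> \<open>Not being lower in the ramp means not being further left, so \<open>m\<close>
      in \<open>F\<close> would force \<open>n\<close> into \<open>F\<close>.\<close>
    have "\<not> snd m < snd n"
      using ramp_eq_row_less[OF p, of "fst n" "snd n" ?l "fst m" "snd m"] ml nl m by simp
    then have "m \<notin> F" using restrictisation_left[OF p _ ml nl] n unfolding F_def by auto
    then show "m \<in> (E - F) \<inter> ramp p ?l" using mE ml by blast
  qed
  then show ?thesis
    unfolding card_ramp_difference[symmetric] by (rule card_mono[rotated]) (simp add: finite_ramp[OF p])
qed

text \<open>By \<open>in_set_reduceI\<close> it suffices that no segment \<open>ms\<close> directly
  after \<open>n\<close> has more plus than minus signs. Let \<open>k\<close> be the last ramp with
  an addable node of \<open>ms\<close>. As \<open>D\<close> has no addable \<open>i\<close>-nodes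
  after the ramp of \<open>n\<close>, the balance up to \<open>k\<close> pays for each plus with a
  removable node of \<open>E\<close>, and \<open>card_above_le\<close> absorbs those removable nodes
  that do not come after \<open>n\<close>.\<close>

private lemma difference_normal:
  assumes no_pair: "\<And>m n. m \<in> removable_nodes p i D \<Longrightarrow> n \<in> addable_nodes p i D \<Longrightarrow>
    ramp_index p n \<le> ramp_index p m"
  shows "E - F \<subseteq> normal_nodes p i E"
proof
  fix n assume n: "n \<in> E - F"
  let ?g = "\<lambda>n. (if n \<in> addable_nodes p i E then Plus else Minus, n)"
  let ?A = "addable_nodes p i E" and ?R = "removable_nodes p i E"
  let ?l = "ramp_index p n"
  note before = row_less_of_ramp_index_less[OF p i D, folded E_def]
  have nR: "n \<in> ?R" using n difference_removable by blast
  then have "n \<notin> ?A" using removable_disjoint_addable by blast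
  obtain ns where ns: "signature p i E = map ?g ns" "set ns = ?A \<union> ?R"
      "sorted_wrt (\<lambda>m n. fst m < fst n) ns"
    by (rule signature_obtain[OF p i E])
  have dist: "distinct ns"
    using ns(3) by (simp add: strict_sorted_iff distinct_map flip: sorted_wrt_map[of "(<)" fst])
  obtain us vs where uv: "ns = us @ n # vs" using nR ns(2) split_list[of n ns] by blast
  have "(Minus, n) \<in> set (reduce (map ?g us @ (Minus, n) # map ?g vs))"
  proof (rule in_set_reduceI)
    fix ys zs assume "map ?g vs = ys @ zs"
    then obtain ms ws where ms: "vs = ms @ ws" "ys = map ?g ms" unfolding map_eq_append_conv by blast
    have sub: "set ms \<subseteq> ?A \<union> ?R" using ns(2) unfolding uv ms by auto
    have dms: "distinct ms" using dist unfolding uv ms by simp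
    have mem: "m \<in> set ms" if "m \<in> ?A \<union> ?R" "x \<in> set ms" "fst n < fst m" "fst m \<le> fst x" for m x
    proof -
      have "m \<in> set us \<or> m = n \<or> m \<in> set ms \<or> m \<in> set ws"
        using that(1) ns(2) unfolding uv ms by auto
      moreover have "\<forall>y\<in>set us. fst y < fst n" "\<forall>y\<in>set ms. \<forall>z\<in>set ws. fst y < fst z"
        using ns(3) unfolding uv ms by (auto simp: sorted_wrt_append)
      ultimately show ?thesis using that(2-4) by (meson leD less_asym less_irrefl)
    qed
    have after: "fst n < fst m" if "m \<in> set ms" for m
      using that ns(3) unfolding uv ms by (simp add: sorted_wrt_append)
    have "card (set ms \<inter> ?A) \<le> card (set ms \<inter> ?R)"
    proof (cases "set ms \<inter> ?A = {}")
      case False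
      let ?M = "Max (ramp_index p ` (set ms \<inter> ?A))"
      have "?M \<in> ramp_index p ` (set ms \<inter> ?A)" using False by (intro Max_in) auto
      then obtain x where x: "x \<in> set ms" "x \<in> ?A" "?M = ramp_index p x" by blast
      have max: "ramp_index p m \<le> ramp_index p x" if "m \<in> set ms \<inter> ?A" for m
        unfolding x(3)[symmetric] using that by (intro Max_ge) auto
      define k where "k = ramp_index p x"
      \<comment> \<open>An addable node in the ramp of \<open>n\<close> or in an earlier one would
        come before \<open>n\<close>.\<close>
      have later: "?l < ramp_index p m" if m: "m \<in> set ms \<inter> ?A" for m
      proof (rule ccontr)
        assume "\<not> ?l < ramp_index p m"
        then consider "ramp_index p m < ?l" | "?l = ramp_index p m" by linarith
        then have "fst m < fst n"
        proof cases
          case 1 then show ?thesis using before[of m n] m nR by blast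
        next
          case 2 then show ?thesis
            using addable_above_removable_in_ramp[OF p i D, folded E_def, OF nR] m by blast
        qed
        then show False using after[of m] m by simp
      qed
      have lk: "?l < k" unfolding k_def using later x by blast
      have modl: "?l mod p = i" using difference_ramp_index[OF n] .
      have modk: "k mod p = i" unfolding k_def using residue_nodes_ramp_index(2)[OF E i] x by blast
      let ?RD = "{m \<in> removable_nodes p i D. ramp_index p m = ?l}"
      have "n \<in> (E - F) \<inter> ramp p ?l" using n mem_ramp by blast
      then have "card ((E - F) \<inter> ramp p ?l) \<noteq> 0" using finite_ramp[OF p] by auto
      then have "?RD \<noteq> {}" unfolding card_ramp_difference by (intro notI) simp
      \<comment> \<open>Some removable \<open>i\<close>-node of \<open>D\<close> is in the ramp of
        \<open>n\<close>, so \<open>no_pair\<close> excludes addable ones in later ramps.\<close>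
      then have "{m \<in> addable_nodes p i D. ?l < ramp_index p m \<and> ramp_index p m \<le> k} = {}"
        using no_pair by fastforce
      then have noA: "card {m \<in> addable_nodes p i D. ?l < ramp_index p m \<and> ramp_index p m \<le> k} = 0"
        by (simp only: card.empty)
      have bal: "card {m \<in> ?R. ?l \<le> ramp_index p m \<and> ramp_index p m < k} +
          card {m \<in> addable_nodes p i D. ?l < ramp_index p m \<and> ramp_index p m \<le> k} =
        card {m \<in> removable_nodes p i D. ?l \<le> ramp_index p m \<and> ramp_index p m < k} +
          card {m \<in> ?A. ?l < ramp_index p m \<and> ramp_index p m \<le> k}"
        using interval_balance[OF p E D _ i modl modk] card_restrictisation_ramp[OF p]
        unfolding E_def by blast
      have "card (set ms \<inter> ?A) \<le> card {m \<in> ?A. ?l < ramp_index p m \<and> ramp_index p m \<le> k}"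
        using later max finite_addable_nodes[OF E] unfolding k_def by (intro card_mono) auto
      moreover have "card ?RD \<le> card {m \<in> removable_nodes p i D. ?l \<le> ramp_index p m \<and> ramp_index p m < k}"
        using lk finite_removable_nodes[OF D] by (intro card_mono) auto
      \<comment> \<open>Removable nodes in ramps before \<open>k\<close> come before
        \<open>x\<close>. Those that also come after \<open>n\<close> are in \<open>ms\<close>; the
        others are in the ramp of \<open>n\<close>, at or above \<open>n\<close>.\<close>
      moreover have "card {m \<in> ?R. ?l \<le> ramp_index p m \<and> ramp_index p m < k} \<le>
        card (set ms \<inter> ?R \<union> {m \<in> ?R. ramp_index p m = ?l \<and> fst m \<le> fst n})"
      proof (rule card_mono)
        show "{m \<in> ?R. ?l \<le> ramp_index p m \<and> ramp_index p m < k} \<subseteq>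
          set ms \<inter> ?R \<union> {m \<in> ?R. ramp_index p m = ?l \<and> fst m \<le> fst n}"
        proof
          fix m assume m: "m \<in> {m \<in> ?R. ?l \<le> ramp_index p m \<and> ramp_index p m < k}"
          show "m \<in> set ms \<inter> ?R \<union> {m \<in> ?R. ramp_index p m = ?l \<and> fst m \<le> fst n}"
          proof (cases "ramp_index p m = ?l \<and> fst m \<le> fst n")
            case False
            have "fst n < fst m"
            proof (cases "ramp_index p m = ?l")
              case neq: False
              then have "?l < ramp_index p m" using m by auto
              then show ?thesis using before[of n m] nR m by blast
            qed (use False in simp)
            moreover have "fst m < fst x" using before[of m x] m x unfolding k_def by blast
            ultimately have "m \<in> set ms" using mem[of m x] m x by simp
            then show ?thesis using m by blast
          qed (use m in blast)
        qed
      qed (use finite_removable_nodes[OF E] in simp)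
      moreover have "\<dots> \<le> card (set ms \<inter> ?R) + card {m \<in> ?R. ramp_index p m = ?l \<and> fst m \<le> fst n}"
        by (rule card_Un_le)
      ultimately show ?thesis using card_above_le[OF n] bal noA by linarith
    qed simp
    then show "sign_count Plus ys \<le> sign_count Minus ys"
      unfolding ms(2) sign_count_map[OF sub dms] .
  qed
  then have "(Minus, n) \<in> set (reduced_signature p i E)"
    unfolding reduced_signature_eq_reduce ns(1) uv using \<open>n \<notin> ?A\<close> by simp
  then show "n \<in> normal_nodes p i E" unfolding normal_nodes_def by simp
qed

text \<open>The \<open>rem p i D\<close> nodes of \<open>E - F\<close> are normal, and the upper
  bound leaves no room for others.\<close>

lemma normal_nodes_restrictisation:
  assumes "\<And>m n. m \<in> removable_nodes p i D \<Longrightarrow> n \<in> addable_nodes p i D \<Longrightarrow>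
    ramp_index p n \<le> ramp_index p m"
  shows "nor p i (restrictisation p D) = rem p i D"
    and "remove_normal p i (restrictisation p D) = restrictisation p (remove_removable p i D)"
proof -
  have sub: "E - F \<subseteq> normal_nodes p i E" by (rule difference_normal[OF assms])
  then have "rem p i D \<le> nor p i E"
    using card_mono[OF finite_normal_nodes sub] unfolding card_difference nor_def by simp
  then have nor: "nor p i E = rem p i D"
    using nor_restrictisation_le(1)[OF p i D] unfolding E_def by simp
  then show "nor p i (restrictisation p D) = rem p i D" unfolding E_def .
  have "E - F = normal_nodes p i E"
    using card_subset_eq[OF finite_normal_nodes sub] nor card_difference unfolding nor_def by simp
  then have "remove_normal p i E = F" using F_subset_E unfolding remove_normal_def by blast
  then show "remove_normal p i (restrictisation p D) = restrictisation p (remove_removable p i D)"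
    unfolding E_def F_def .
qed

end

theorem proposition4p9:
  fixes p i :: nat and lam :: "node set"
  assumes "prime p" and "is_partition lam" and "i < p"
  shows "nor p i (restrictisation p lam) \<le> rem p i lam \<and>
         (nor p i (restrictisation p lam) = rem p i lam \<longleftrightarrow>
            \<not> (\<exists>m \<in> removable_nodes p i lam. \<exists>n \<in> addable_nodes p i lam.
                 ramp_index p n > ramp_index p m)) \<and>
         (nor p i (restrictisation p lam) = rem p i lam \<longrightarrow>
            remove_normal p i (restrictisation p lam) =
            restrictisation p (remove_removable p i lam))"
proof -
  have p: "2 \<le> p" using assms(1) by (rule prime_ge_2_nat)
  let ?E = "restrictisation p lam"
  let ?pair = "\<exists>m \<in> removable_nodes p i lam. \<exists>n \<in> addable_nodes p i lam.
    ramp_index p n > ramp_index p m"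
  have "nor p i ?E = rem p i lam \<Longrightarrow> \<not> ?pair"
    using nor_restrictisation_le(2)[OF p assms(3,2)] by (meson leD)
  moreover have "nor p i ?E = rem p i lam"
    "remove_normal p i ?E = restrictisation p (remove_removable p i lam)" if "\<not> ?pair"
    using normal_nodes_restrictisation[OF p assms(3,2)] that by (meson not_le)+
  ultimately show ?thesis using nor_restrictisation_le(1)[OF p assms(3,2)] by blast
qed

end
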